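(* Fix a positive integer $k$. Let $q$ be a positive integer that is divisible by the cube of every prime that divides it. For each positive integer $\ell$ let $\mathcal{B}(\ell)$ and $\mathcal{B}^*(\ell)$ denote arbitrary orthonormal bases of $\mathcal{A}(\ell)$ and $\mathcal{A}^*(\ell)$, respectively, with respect to the normalized Petersson inner product. Then for all $z_1, z_2$ in the upper half-plane, $$\sum_{\varphi \in \mathcal{B}^*(q)} \varphi(z_1)\, \overline{\varphi(z_2)} = \sum_{d, e \mid q} \mu(d)\mu(e) \sum_{\varphi \in \mathcal{B}(\frac{q}{de})} \varphi|_d(z_1)\, \overline{\varphi|_d(z_2)}.$$
   Context: For a positive integer $\ell$, $\mathcal{A}(\ell)$ is the (finite-dimensional) space of weight $k$ holomorphic cusp forms on $\Gamma_0(\ell)$. It carries the Petersson inner product $\langle f, g\rangle = \int_{\Gamma_0(\ell)\backslash\mathbb{H}} f(z)\overline{g(z)}\, y^k \, d\mu_\ell(z)$, where $d\mu_\ell$ is a multiple of the hyperbolic measure $\frac{dx\,dy}{y^2}$ normalized so that the total volume of $\Gamma_0(\ell)\backslash\mathbb{H}$ is a constant independent of $\ell$ (for instance $d\mu_\ell = \operatorname{vol}(\Gamma_0(\ell)\backslash\mathbb{H})^{-1}\frac{dx\,dy}{y^2}$). For $\varphi \in \mathcal{A}(\ell)$ and a positive integer $d$, $\varphi|_d(z) := d^{k/2}\varphi(dz)$. With the Petersson inner products normalized so that the total volume of $\Gamma_0(\ell)\backslash\mathbb{H}$ with respect to $d\mu_\ell$ is a constant independent of $\ell$, $\varphi\mapsto\varphi|_d$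 preserves inner products. The oldspace of $\mathcal{A}(\ell)$ is the span of the forms $\varphi|_d$ taken over all divisors $\ell' \neq \ell$ of $\ell$, all divisors $d$ of $\ell/\ell'$, and all $\varphi\in\mathcal{A}(\ell')$. The newspace $\mathcal{A}^*(\ell)$ is the orthogonal complement of the oldspace in $\mathcal{A}(\ell)$. $\mu$ is the Möbius function. Terms with $\mu(d)\mu(e)=0$ are understood to be zero; when $d,e$ are squarefree divisors of $q$, the hypothesis on $q$ ensures $de\mid q$. *)

theory Defs
  imports
    "HOL-Complex_Analysis.Complex_Analysis"
    "HOL-Computational_Algebra.Squarefree"
    "HOL-Library.Function_Algebras"
begin

definition uhp :: "complex set" where
  "uhp = {z. Im z > 0}"

definition SL2Z :: "(int^2^2) set" where
  "SL2Z = {A. det A = 1}"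

definition Gamma0 :: "nat \<Rightarrow> (int^2^2) set" where
  "Gamma0 l = {A \<in> SL2Z. int l dvd A $ 2 $ 1}"

definition autf :: "int^2^2 \<Rightarrow> complex \<Rightarrow> complex" where
  "autf A z = of_int (A $ 2 $ 1) * z + of_int (A $ 2 $ 2)"

definition act :: "int^2^2 \<Rightarrow> complex \<Rightarrow> complex" where
  "act A z = (of_int (A $ 1 $ 1) * z + of_int (A $ 1 $ 2)) / autf A z"

definition slash :: "nat \<Rightarrow> (complex \<Rightarrow> complex) \<Rightarrow> int^2^2 \<Rightarrow> complex \<Rightarrow> complex" where
  "slash k f A z = f (act A z) / autf A z ^ k"

text \<open>
  A function on the upper half-plane is represented by its extension by zero to the whole
  complex plane, so that equality of forms is equality of functions. Since every cusp is an
  \<open>SL2Z\<close>-translate of infinity, vanishing at all cusps means that all translates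
  \<open>slash k f A\<close> tend to zero as the imaginary part tends to infinity, uniformly in the real part.
\<close>

definition cusp_forms :: "nat \<Rightarrow> nat \<Rightarrow> (complex \<Rightarrow> complex) set" where
  "cusp_forms k l = {f.
     (\<forall>z. z \<notin> uhp \<longrightarrow> f z = 0) \<and>
     f holomorphic_on uhp \<and>
     (\<forall>A \<in> Gamma0 l. \<forall>z \<in> uhp. slash k f A z = f z) \<and>
     (\<forall>A \<in> SL2Z. (slash k f A \<longlongrightarrow> 0) (filtercomap Im at_top))}"

definition hyp_measure :: "complex measure" where
  "hyp_measure = density lborel (\<lambda>z. ennreal (indicator uhp z / (Im z)\<^sup>2))"

text \<open>
  Integration over the quotient of the upper half-plane by \<open>Gamma0 l\<close> is integration over a Borel
  set of orbit representatives. Such sets exist, and invariant functions have the same integral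
  over any two of them.
\<close>

definition fundamental_set :: "nat \<Rightarrow> complex set \<Rightarrow> bool" where
  "fundamental_set l F \<longleftrightarrow> F \<in> sets borel \<and> F \<subseteq> uhp \<and>
     (\<forall>z \<in> uhp. \<exists>!w. w \<in> F \<and> (\<exists>A \<in> Gamma0 l. w = act A z))"

definition fund :: "nat \<Rightarrow> complex set" where
  "fund l = (SOME F. fundamental_set l F)"

definition vol :: "nat \<Rightarrow> real" where
  "vol l = measure hyp_measure (fund l)"

text \<open>
  The parameter \<open>c\<close> is the total volume of the quotient for the normalized measure; it does not
  depend on the level.
\<close>

definition petersson ::
  "real \<Rightarrow> nat \<Rightarrow> nat \<Rightarrow> (complex \<Rightarrow> complex) \<Rightarrow> (complex \<Rightarrow> complex) \<Rightarrow> complex" where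
  "petersson c k l f g = of_real (c / vol l) *
     (LINT z:fund l|hyp_measure. f z * cnj (g z) * of_real (Im z ^ k))"

global_interpretation cfun: vector_space "\<lambda>(a::complex) (f::complex \<Rightarrow> complex) z. a * f z"
  defines cspan = cfun.span
  by unfold_locales (auto simp: fun_eq_iff algebra_simps)

definition level_raise :: "nat \<Rightarrow> nat \<Rightarrow> (complex \<Rightarrow> complex) \<Rightarrow> complex \<Rightarrow> complex" where
  "level_raise k d f z = of_real (real d powr (real k / 2)) * f (of_nat d * z)"

definition oldspace :: "nat \<Rightarrow> nat \<Rightarrow> (complex \<Rightarrow> complex) set" where
  "oldspace k l = cspan {level_raise k d f | l' d f.
     l' dvd l \<and> l' \<noteq> l \<and> d dvd l div l' \<and> f \<in> cusp_forms k l'}"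

definition newspace :: "real \<Rightarrow> nat \<Rightarrow> nat \<Rightarrow> (complex \<Rightarrow> complex) set" where
  "newspace c k l = {f \<in> cusp_forms k l. \<forall>g \<in> oldspace k l. petersson c k l f g = 0}"

text \<open>
  The spaces of cusp forms are finite-dimensional, so requiring a basis to be finite is no
  restriction.
\<close>

definition orthonormal_basis ::
  "real \<Rightarrow> nat \<Rightarrow> nat \<Rightarrow> (complex \<Rightarrow> complex) set \<Rightarrow> (complex \<Rightarrow> complex) set \<Rightarrow> bool" where
  "orthonormal_basis c k l V B \<longleftrightarrow> finite B \<and> B \<subseteq> V \<and> cspan B = V \<and>
     (\<forall>f \<in> B. \<forall>g \<in> B. petersson c k l f g = (if f = g then 1 else 0))"

definition mobius_mu :: "nat \<Rightarrow> int" where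
  "mobius_mu n = (if squarefree n then (-1) ^ card (prime_factors n) else 0)"

end

(*
  Write E_p for averaging a form f of level q over its translates f(z + j/p) and T_p for averaging
  over its transforms under the lower unipotents with entry j q/p.  Since p^3 divides q, these are
  commuting orthogonal projections, onto the forms raised by p from level q/p and onto the forms of
  level q/p, and these two kinds of forms span the oldspace.  The projection onto the newspace is
  the product of all (1 - E_p)(1 - T_p); expanding it gives the Moebius sum, the (d, e) term being
  the projection onto the forms raised by d from level q/(d e).

  It is convenient to replace the projections by the adjoints of level raising, which are explicit
  coset sums (traces) from level q to level q/(d e); adjointness is an unfolding argument for the
  hyperbolic measure.  The trace of a form that comes from level q/p is again of lower level, so the
  terms e and e p (or d and d p) of the Moebius sum cancel when it is paired with an old form.
*)

theory Submission imports Defs begin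

text \<open>Cubes enter because d and e are squarefree: every prime of d e still divides q/(d e).
  The index behind a trace to level q/(d e) is then exactly d e, and each representative is one
  upper times one lower unipotent; a prime missing from q/(d e) would bring further cosets. With its
  second point w fixed, the Moebius sum is treated as a form in the first point. It suffices that
  this form lies in the newspace and that pairing a newform with it evaluates the newform at w;
  expanding it in the new basis then gives the identity, whatever the bases are. Two analytic
  obstacles are met without geometry at the cusps. Fundamental sets are arbitrary Borel sets of
  representatives, so unfolding counts group elements, two for almost every point, instead of
  cutting up a domain. Convergence of Petersson integrals is read off from the given orthonormal
  bases instead of from the decay of cusp forms.\<close>

no_notation fps_nth (infixl "$" 75)

subsection \<open>Integral two-by-two matrices and the slash action\<close>

definition mat2 :: "int \<Rightarrow> int \<Rightarrow> int \<Rightarrow> int \<Rightarrow> int^2^2" where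
  "mat2 a b c d = vector [vector [a, b], vector [c, d]]"

lemma mat2_nth [simp]:
  "mat2 a b c d $ 1 $ 1 = a" "mat2 a b c d $ 1 $ 2 = b"
  "mat2 a b c d $ 2 $ 1 = c" "mat2 a b c d $ 2 $ 2 = d"
  by (simp_all add: mat2_def)

lemma mat2_eq_iff: "A = B \<longleftrightarrow> A $ 1 $ 1 = B $ 1 $ 1 \<and> A $ 1 $ 2 = B $ 1 $ 2 \<and>
    A $ 2 $ 1 = B $ 2 $ 1 \<and> A $ 2 $ 2 = B $ 2 $ 2" for A B :: "int^2^2"
  by (auto simp: vec_eq_iff forall_2)

lemma mat2_surj: "A = mat2 (A $ 1 $ 1) (A $ 1 $ 2) (A $ 2 $ 1) (A $ 2 $ 2)"
  by (simp add: mat2_eq_iff)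

lemma mat2_mult [simp]:
  "mat2 a b c d ** mat2 a' b' c' d' =
    mat2 (a * a' + b * c') (a * b' + b * d') (c * a' + d * c') (c * b' + d * d')"
  by (simp add: mat2_eq_iff matrix_matrix_mult_def sum_2)

lemma det_mat2 [simp]: "det (mat2 a b c d) = a * d - b * c"
  by (simp add: det_2)

lemma mat_1_mat2: "mat 1 = mat2 1 0 0 1"
  by (simp add: mat2_eq_iff mat_def)

text \<open>The adjugate: the inverse on \<open>SL2Z\<close>, and integral for every matrix.\<close>

definition adj :: "int^2^2 \<Rightarrow> int^2^2" where
  "adj A = mat2 (A $ 2 $ 2) (- (A $ 1 $ 2)) (- (A $ 2 $ 1)) (A $ 1 $ 1)"

lemma adj_mat2 [simp]: "adj (mat2 a b c d) = mat2 d (-b) (-c) a"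
  by (simp add: adj_def)

lemma mat2_SL2Z: "mat2 a b c d \<in> SL2Z \<longleftrightarrow> a * d - b * c = 1"
  by (simp add: SL2Z_def)

lemma mat2_cases: obtains a b c d where "A = mat2 a b c d"
  using mat2_surj by blast

lemma SL2Z_cases:
  assumes "A \<in> SL2Z" obtains a b c d where "A = mat2 a b c d" "a * d - b * c = 1"
  using assms by (metis mat2_SL2Z mat2_surj)

lemma adj_adj [simp]: "adj (adj A) = A"
  by (simp add: mat2_eq_iff adj_def)

lemma adj_right: "A \<in> SL2Z \<Longrightarrow> A ** adj A = mat 1"
  and adj_left: "A \<in> SL2Z \<Longrightarrow> adj A ** A = mat 1"
  by (auto elim!: SL2Z_cases simp: mat_1_mat2 algebra_simps)

lemma adj_SL2Z [simp]: "adj A \<in> SL2Z \<longleftrightarrow> A \<in> SL2Z"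
  by (cases A rule: mat2_cases) (simp add: mat2_SL2Z algebra_simps)

lemma mult_SL2Z: "A \<in> SL2Z \<Longrightarrow> B \<in> SL2Z \<Longrightarrow> A ** B \<in> SL2Z"
  by (simp add: SL2Z_def det_mul)

lemma adj_mult: "adj (A ** B) = adj B ** adj A"
  by (cases A rule: mat2_cases, cases B rule: mat2_cases) (simp add: algebra_simps)

lemma uhp_iff [simp]: "z \<in> uhp \<longleftrightarrow> Im z > 0"
  by (simp add: uhp_def)

lemma open_uhp: "open uhp"
  unfolding uhp_def by (rule open_halfspace_Im_gt)

lemma autf_mat2 [simp]: "autf (mat2 a b c d) z = of_int c * z + of_int d"
  and act_mat2 [simp]: "act (mat2 a b c d) z = (of_int a * z + of_int b) / (of_int c * z + of_int d)"
  by (simp_all add: autf_def act_def)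

lemma autf_nonzero:
  assumes "det A \<noteq> 0" "Im z > 0" shows "autf A z \<noteq> 0"
proof
  assume *: "autf A z = 0"
  obtain a b c d where A: "A = mat2 a b c d" by (rule mat2_cases)
  have "of_int c * Im z = 0" using arg_cong[OF *, of Im] A by simp
  hence "c = 0" using assms by simp
  moreover have "d = 0" using * A \<open>c = 0\<close> by simp
  ultimately show False using assms A by simp
qed

text \<open>True at every z: where \<open>autf A z\<close> vanishes, division by zero makes both
  sides zero. Hence the complement of the half-plane is preserved too, and forms extended by zero
  stay so under \<open>slash\<close>.\<close>

lemma Im_act: "Im (act A z) = of_int (det A) * Im z / (cmod (autf A z))\<^sup>2"
proof (cases A rule: mat2_cases)
  case (1 a b c d)
  show ?thesis unfolding 1 
    by (simp add: Im_divide cmod_def) (simp add: field_simps power2_eq_square)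
qed

lemma act_uhp: "det A > 0 \<Longrightarrow> Im z > 0 \<Longrightarrow> Im (act A z) > 0"
  using autf_nonzero[of A z] by (simp add: Im_act)

lemma act_not_uhp: "det A > 0 \<Longrightarrow> \<not> Im z > 0 \<Longrightarrow> \<not> Im (act A z) > 0"
  by (simp add: Im_act not_less divide_nonpos_nonneg mult_nonneg_nonpos)

lemma SL2Z_det [simp]: "A \<in> SL2Z \<Longrightarrow> det A = 1"
  by (simp add: SL2Z_def)

lemma autf_mult:
  assumes "det B \<noteq> 0" "Im z > 0"
  shows "autf (A ** B) z = autf A (act B z) * autf B z"
proof -
  obtain a b c d where A: "A = mat2 a b c d" by (rule mat2_cases)
  obtain a' b' c' d' where B: "B = mat2 a' b' c' d'" by (rule mat2_cases)
  define D where "D = of_int c' * z + of_int d'"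
  have D: "D \<noteq> 0" using autf_nonzero[OF assms] by (simp add: B D_def)
  show ?thesis
    unfolding A B mat2_mult autf_mat2 act_mat2 D_def[symmetric] using D
    by (simp add: distrib_right) (simp add: D_def algebra_simps)
qed

lemma act_mult:
  assumes "det B > 0" "Im z > 0"
  shows "act (A ** B) z = act A (act B z)"
proof -
  have *: "autf B z \<noteq> 0" using assms autf_nonzero by force
  obtain a b c d where A: "A = mat2 a b c d" by (rule mat2_cases)
  obtain a' b' c' d' where B: "B = mat2 a' b' c' d'" by (rule mat2_cases)
  define N D where "N = of_int a' * z + of_int b'" and "D = of_int c' * z + of_int d'"
  have D: "D \<noteq> 0" using * by (simp add: B D_def)
  have "act (A ** B) z = (of_int a * N + of_int b * D) / (of_int c * N + of_int d * D)"
    unfolding A B by (simp add: N_def D_def algebra_simps)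
  also have "\<dots> = ((of_int a * N + of_int b * D) / D) / ((of_int c * N + of_int d * D) / D)"
    using D by simp
  also have "\<dots> = act A (N / D)"
    using D unfolding A act_mat2 by (simp add: add_divide_distrib)
  finally show ?thesis by (simp add: B N_def D_def)
qed

lemma act_mat_1 [simp]: "act (mat 1) z = z"
  by (simp add: mat_1_mat2)

lemma act_adj: "A \<in> SL2Z \<Longrightarrow> Im z > 0 \<Longrightarrow> act (adj A) (act A z) = z"
  and act_adj': "A \<in> SL2Z \<Longrightarrow> Im z > 0 \<Longrightarrow> act A (act (adj A) z) = z"
  by (simp_all add: act_mult[symmetric] adj_left adj_right)

lemma slash_mult:
  assumes "det B > 0" "Im z > 0"
  shows "slash k (slash k f A) B z = slash k f (A ** B) z"
  using assms by (simp add: slash_def act_mult autf_mult power_mult_distrib)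

lemma slash_cong: "(\<And>z. Im z > 0 \<Longrightarrow> f z = g z) \<Longrightarrow> det A > 0 \<Longrightarrow> Im z > 0 \<Longrightarrow>
    slash k f A z = slash k g A z"
  by (simp add: slash_def act_uhp)

lemma slash_not_uhp: "(\<And>z. \<not> Im z > 0 \<Longrightarrow> f z = 0) \<Longrightarrow> det A > 0 \<Longrightarrow> \<not> Im z > 0 \<Longrightarrow>
    slash k f A z = 0"
  by (simp add: slash_def act_not_uhp)

lemma slash_sum: "slash k (\<lambda>z. \<Sum>i\<in>I. f i z) A z = (\<Sum>i\<in>I. slash k (f i) A z)"
  by (simp add: slash_def sum_divide_distrib)

lemma slash_scale: "slash k (\<lambda>z. a * f z) A z = a * slash k f A z"
  by (simp add: slash_def)

lemma act_holomorphic: "det A > 0 \<Longrightarrow> act A holomorphic_on uhp"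
  unfolding act_def using autf_nonzero[of A] unfolding autf_def
  by (intro holomorphic_intros) auto

lemma slash_holomorphic:
  assumes "f holomorphic_on uhp" "det A > 0"
  shows "slash k f A holomorphic_on uhp"
proof -
  have "(f \<circ> act A) holomorphic_on uhp"
    using assms act_uhp by (intro holomorphic_on_compose_gen[OF act_holomorphic assms(1)]) auto
  moreover have "autf A holomorphic_on uhp"
    unfolding autf_def by (intro holomorphic_intros)
  ultimately have "(\<lambda>z. (f \<circ> act A) z / autf A z ^ k) holomorphic_on uhp"
    using assms(2) autf_nonzero[of A]
    by (intro holomorphic_on_divide holomorphic_on_power) (auto simp: o_def)
  thus ?thesis by (simp add: slash_def[abs_def])
qed

section \<open>The cusp condition under matrices of positive determinant\<close>

lemma eventually_uhp: "eventually (\<lambda>z. Im z > 0) (filtercomap Im at_top)"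
  by (intro eventually_filtercomapI eventually_gt_at_top)

text \<open>The first column divided by its gcd is primitive, so Bezout completes it to a matrix S
  of determinant one; \<open>adj S ** A\<close> then has lower left entry zero.\<close>

lemma hermite_decomposition:
  assumes "det A > 0"
  obtains S a b d where "S \<in> SL2Z" "A = S ** mat2 a b 0 d" "a > 0" "d > 0"
proof -
  obtain x y z w where A: "A = mat2 x y z w" by (rule mat2_cases)
  have det: "x * w - y * z > 0" using assms A by simp
  define g where "g = gcd x z"
  have g: "g > 0" using det by (auto simp: g_def)
  define x' z' where "x' = x div g" and "z' = z div g"
  have xz: "x = g * x'" "z = g * z'" by (simp_all add: x'_def z'_def g_def)
  have "coprime x' z'" using g by (simp add: x'_def z'_def g_def div_gcd_coprime)
  then obtain u v where uv: "u * x' + v * z' = 1"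
    by (metis bezout_int coprime_iff_gcd_eq_1)
  define S where "S = mat2 x' (-v) z' u"
  have S: "S \<in> SL2Z" using uv by (simp add: S_def mat2_SL2Z algebra_simps)
  have eq: "adj S ** A = mat2 g (u * y + v * w) 0 (x' * w - z' * y)"
    using uv unfolding S_def A xz by (simp add: mat2_eq_iff algebra_simps)
       (metis distrib_left mult.right_neutral mult.assoc mult.commute)
  have "g * (x' * w - z' * y) > 0" using det by (simp add: xz algebra_simps)
  hence "x' * w - z' * y > 0" using g by (simp add: zero_less_mult_iff)
  moreover have "A = S ** mat2 g (u * y + v * w) 0 (x' * w - z' * y)"
    by (metis eq adj_right[OF S] matrix_mul_assoc matrix_mul_lid)
  ultimately show ?thesis using S g that by blast
qed

text \<open>The cusp condition of \<open>cusp_forms\<close> without invariance, so that it can be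
  carried along by matrices that change the group.\<close>

definition cuspidal :: "nat \<Rightarrow> (complex \<Rightarrow> complex) \<Rightarrow> bool" where
  "cuspidal k f \<longleftrightarrow> (\<forall>A\<in>SL2Z. (slash k f A \<longlongrightarrow> 0) (filtercomap Im at_top))"

text \<open>After splitting off the \<open>SL2Z\<close> factor, the remaining triangular matrix
  multiplies imaginary parts by a/d > 0 and so respects the approach to infinity.\<close>

lemma cuspidal_slash_tendsto:
  assumes "cuspidal k f" "det A > 0"
  shows "(slash k f A \<longlongrightarrow> 0) (filtercomap Im at_top)"
proof -
  obtain S a b d where S: "S \<in> SL2Z" and A: "A = S ** mat2 a b 0 d" and ad: "a > 0" "d > 0"
    using hermite_decomposition[OF assms(2)] by metis
  have lim: "(slash k f S \<longlongrightarrow> 0) (filtercomap Im at_top)"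
    using assms(1) S by (simp add: cuspidal_def)
  have "filterlim (\<lambda>y. of_int a / of_int d * y) at_top (at_top :: real filter)"
    using ad by (intro filterlim_tendsto_pos_mult_at_top[OF tendsto_const] filterlim_ident) auto
  moreover have "Im \<circ> act (mat2 a b 0 d) = (\<lambda>y. of_int a / of_int d * y) \<circ> Im"
    by (auto simp: fun_eq_iff Im_divide power2_eq_square)
  ultimately have "filterlim (act (mat2 a b 0 d)) (filtercomap Im at_top) (filtercomap Im at_top)"
    unfolding filterlim_filtercomap_iff by (simp only: filterlim_compose[OF _ filterlim_filtercomap] o_def)
  from filterlim_compose[OF lim this]
  have "((\<lambda>z. slash k f S (act (mat2 a b 0 d) z) / of_int d ^ k) \<longlongrightarrow> 0 / of_int d ^ k)
      (filtercomap Im at_top)"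
    using ad by (intro tendsto_divide tendsto_const) auto
  hence *: "(slash k (slash k f S) (mat2 a b 0 d) \<longlongrightarrow> 0) (filtercomap Im at_top)"
    by (simp add: slash_def[of k "slash k f S" "mat2 a b 0 d", abs_def])
  have "eventually (\<lambda>z. slash k (slash k f S) (mat2 a b 0 d) z = slash k f A z) (filtercomap Im at_top)"
    using eventually_uhp
  proof eventually_elim
    case (elim z)
    thus ?case using ad unfolding A by (intro slash_mult) simp_all
  qed
  from tendsto_cong[OF this] * show ?thesis by simp
qed

lemma cuspidal_slash:
  assumes "cuspidal k f" "det A > 0" shows "cuspidal k (slash k f A)"
  unfolding cuspidal_def
proof
  fix B assume B: "B \<in> SL2Z"
  have "eventually (\<lambda>z. slash k (slash k f A) B z = slash k f (A ** B) z) (filtercomap Im at_top)"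
    using eventually_uhp by eventually_elim (use B in \<open>simp add: slash_mult\<close>)
  moreover have "det (A ** B) > 0" using assms B by (simp add: det_mul)
  ultimately show "(slash k (slash k f A) B \<longlongrightarrow> 0) (filtercomap Im at_top)"
    using cuspidal_slash_tendsto[OF assms(1)] by (simp add: tendsto_cong)
qed

lemma cuspidal_sum:
  assumes "\<And>i. i \<in> I \<Longrightarrow> cuspidal k (f i)"
  shows "cuspidal k (\<lambda>z. \<Sum>i\<in>I. f i z)"
  unfolding cuspidal_def
proof
  fix A assume A: "A \<in> SL2Z"
  have "((\<lambda>z. \<Sum>i\<in>I. slash k (f i) A z) \<longlongrightarrow> (\<Sum>i\<in>I. 0)) (filtercomap Im at_top)"
    by (intro tendsto_sum) (use assms A in \<open>auto simp: cuspidal_def\<close>)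
  thus "(slash k (\<lambda>z. \<Sum>i\<in>I. f i z) A \<longlongrightarrow> 0) (filtercomap Im at_top)"
    by (simp add: slash_sum[abs_def])
qed

lemma cuspidal_scale:
  assumes "cuspidal k f" shows "cuspidal k (\<lambda>z. a * f z)"
  unfolding cuspidal_def
proof
  fix A assume A: "A \<in> SL2Z"
  have "((\<lambda>z. a * slash k f A z) \<longlongrightarrow> a * 0) (filtercomap Im at_top)"
    by (intro tendsto_mult tendsto_const) (use assms A in \<open>auto simp: cuspidal_def\<close>)
  thus "(slash k (\<lambda>z. a * f z) A \<longlongrightarrow> 0) (filtercomap Im at_top)"
    by (simp add: slash_scale[abs_def])
qed

subsection \<open>Invariance of the hyperbolic measure\<close>

lemma uhp_borel [measurable, simp]: "uhp \<in> sets borel"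
  by (rule borel_open[OF open_uhp])

text \<open>Gives access to Fubini in real and imaginary parts; Lebesgue measure is determined by
  its values on boxes.\<close>

lemma lborel_complex:
  "(lborel :: complex measure) = distr (lborel \<Otimes>\<^sub>M lborel) borel (\<lambda>(x, y). Complex x y)"
proof (rule lborel_eqI)
  have meas [measurable]: "(\<lambda>(x, y). Complex x y) \<in> borel_measurable (lborel \<Otimes>\<^sub>M lborel)"
    unfolding Complex_eq by measurable
  fix l u :: complex
  assume "\<And>b. b \<in> Basis \<Longrightarrow> l \<bullet> b \<le> u \<bullet> b"
  from this[of 1] this[of \<i>] have lu: "Re l \<le> Re u" "Im l \<le> Im u"
    by (auto simp: Basis_complex_def)
  have "(\<lambda>(x, y). Complex x y) -` box l u \<inter> space (lborel \<Otimes>\<^sub>M lborel) =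
      {Re l<..<Re u} \<times> {Im l<..<Im u}"
    by (auto simp: space_pair_measure in_box_complex_iff)
  thus "emeasure (distr (lborel \<Otimes>\<^sub>M lborel) borel (\<lambda>(x, y). Complex x y)) (box l u) =
      ennreal (\<Prod>b\<in>Basis. (u - l) \<bullet> b)"
    using lu by (simp add: emeasure_distr lborel.emeasure_pair_measure_Times Basis_complex_def
        ennreal_mult' prod.insert)
qed simp

text \<open>Substitution on the compact intervals from -(n+1) to n+1, followed by continuity of
  measures along their increasing union. \<open>Suc n\<close> keeps every interval
  nondegenerate.\<close>

lemma nn_integral_exp_substitution:
  fixes f :: "real \<Rightarrow> ennreal"
  assumes [measurable]: "f \<in> borel_measurable borel"
  shows "(\<integral>\<^sup>+y. f y * ennreal (1 / y) * indicator {0<..} y \<partial>lborel) = (\<integral>\<^sup>+s. f (exp s) \<partial>lborel)"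
proof -
  define N where "N = density lborel (\<lambda>y. f y * ennreal (1 / y))"
  define N' where "N' = density lborel (\<lambda>s. f (exp s))"
  have eq: "emeasure N {exp (- real (Suc n))..exp (real (Suc n))} = emeasure N' {- real (Suc n)..real (Suc n)}" for n
  proof -
    have "emeasure N {exp (- real (Suc n))..exp (real (Suc n))} =
        (\<integral>\<^sup>+s. (f (exp s) * ennreal (1 / exp s)) * ennreal (exp s) *
          indicator {- real (Suc n)..real (Suc n)} s \<partial>lborel)"
      unfolding N_def by (subst emeasure_density, simp, simp, subst nn_integral_substitution_aux[where g' = exp])
        (auto intro!: derivative_eq_intros continuous_intros)
    also have "\<dots> = emeasure N' {- real (Suc n)..real (Suc n)}"
      unfolding N'_def
      by (simp add: emeasure_density mult.assoc flip: ennreal_mult' mult.assoc exp_minus)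
        (simp add: mult.assoc flip: ennreal_mult' exp_add)
    finally show ?thesis .
  qed
  have U: "(\<Union>n. {exp (- real (Suc n))..exp (real (Suc n))}) = {0<..}"
  proof safe
    fix y :: real assume y: "y > 0"
    obtain n where n: "\<bar>ln y\<bar> \<le> real n" using real_arch_simple by blast
    have "exp (- real (Suc n)) \<le> exp (ln y)" "exp (ln y) \<le> exp (real (Suc n))"
      using n by (auto simp only: exp_le_cancel_iff)
    thus "y \<in> (\<Union>n. {exp (- real (Suc n))..exp (real (Suc n))})" using y by auto
  qed (auto intro: less_le_trans[OF exp_gt_zero])
  have U': "(\<Union>n. {- real (Suc n)..real (Suc n)}) = UNIV"
  proof safe
    fix s :: real
    obtain n where n: "\<bar>s\<bar> \<le> real n" using real_arch_simple by blast
    thus "s \<in> (\<Union>n. {- real (Suc n)..real (Suc n)})" by (intro UN_I[of n]) auto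
  qed auto
  have "emeasure N {0<..} = (SUP n. emeasure N {exp (- real (Suc n))..exp (real (Suc n))})"
    unfolding U[symmetric] by (rule SUP_emeasure_incseq[symmetric]) (auto simp: N_def incseq_def)
  also have "\<dots> = emeasure N' UNIV"
    unfolding U'[symmetric] eq by (rule SUP_emeasure_incseq) (auto simp: N'_def incseq_def)
  finally show ?thesis by (simp add: N_def N'_def emeasure_density)
qed

lemma sets_hyp_measure [simp, measurable_cong]: "sets hyp_measure = sets borel"
  and space_hyp_measure [simp]: "space hyp_measure = UNIV"
  by (simp_all add: hyp_measure_def)

lemma AE_hyp_measure: "AE z in hyp_measure. Im z > 0"
proof -
  have "Measurable.pred borel (\<lambda>z. Im z > 0)" by measurable
  thus ?thesis unfolding hyp_measure_def
    by (subst AE_density) (auto simp: indicator_def split: if_splits)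
qed

text \<open>In the coordinates \<open>exp s * (t + \<i>)\<close> the hyperbolic measure is Lebesgue measure, and scaling
  and inversion become affine maps of \<open>s\<close> and \<open>t\<close>.\<close>

lemma nn_integral_hyp_measure:
  assumes [measurable]: "h \<in> borel_measurable borel"
  shows "(\<integral>\<^sup>+z. h z \<partial>hyp_measure) =
    (\<integral>\<^sup>+t. \<integral>\<^sup>+s. h (Complex (exp s * t) (exp s)) \<partial>lborel \<partial>lborel)"
proof -
  have [measurable]: "(\<lambda>p. Complex (fst p) (snd p)) \<in> borel_measurable (lborel \<Otimes>\<^sub>M lborel)"
    "(\<lambda>p. Complex (f p) (g p)) \<in> borel_measurable M"
    if "f \<in> borel_measurable M" "g \<in> borel_measurable M" for M :: "'z measure" and f g
    using that unfolding Complex_eq by measurable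
  have "(\<integral>\<^sup>+z. h z \<partial>hyp_measure) = (\<integral>\<^sup>+z. ennreal (indicator uhp z / (Im z)\<^sup>2) * h z \<partial>lborel)"
    unfolding hyp_measure_def by (subst nn_integral_density) auto
  also have "\<dots> = (\<integral>\<^sup>+p. ennreal (indicator uhp (Complex (fst p) (snd p)) / (snd p)\<^sup>2) *
      h (Complex (fst p) (snd p)) \<partial>(lborel \<Otimes>\<^sub>M lborel))"
    by (subst lborel_complex, subst nn_integral_distr) (auto simp: case_prod_unfold)
  also have "\<dots> = (\<integral>\<^sup>+y. \<integral>\<^sup>+x. ennreal (indicator uhp (Complex x y) / y\<^sup>2) * h (Complex x y) \<partial>lborel \<partial>lborel)"
    by (subst lborel_pair.nn_integral_snd[symmetric]) auto
  \<comment> \<open>Substituting x = y t, the Jacobian y turns the density 1/y^2 into 1/y, which the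
    later substitution y = exp s absorbs.\<close>
  also have "\<dots> = (\<integral>\<^sup>+y. \<integral>\<^sup>+t. ennreal (1 / y) * indicator {0<..} y * h (Complex (y * t) y) \<partial>lborel \<partial>lborel)"
  proof (rule nn_integral_cong)
    fix y :: real
    show "(\<integral>\<^sup>+x. ennreal (indicator uhp (Complex x y) / y\<^sup>2) * h (Complex x y) \<partial>lborel) =
        (\<integral>\<^sup>+t. ennreal (1 / y) * indicator {0<..} y * h (Complex (y * t) y) \<partial>lborel)"
    proof (cases "y > 0")
      case True
      have "(\<integral>\<^sup>+x. ennreal (indicator uhp (Complex x y) / y\<^sup>2) * h (Complex x y) \<partial>lborel) =
          ennreal \<bar>y\<bar> * (\<integral>\<^sup>+t. ennreal (indicator uhp (Complex (0 + y * t) y) / y\<^sup>2) *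
            h (Complex (0 + y * t) y) \<partial>lborel)"
        using True by (intro nn_integral_real_affine) auto
      also have "\<dots> = (\<integral>\<^sup>+t. ennreal \<bar>y\<bar> * (ennreal (1 / y\<^sup>2) * h (Complex (y * t) y)) \<partial>lborel)"
        using True by (subst nn_integral_cmult[symmetric]) auto
      also have "\<dots> = (\<integral>\<^sup>+t. ennreal (1 / y) * indicator {0<..} y * h (Complex (y * t) y) \<partial>lborel)"
        using True by (intro nn_integral_cong)
          (simp add: power2_eq_square flip: mult.assoc ennreal_mult')
      finally show ?thesis .
    qed simp
  qed
  also have "\<dots> = (\<integral>\<^sup>+t. \<integral>\<^sup>+y. ennreal (1 / y) * indicator {0<..} y * h (Complex (y * t) y) \<partial>lborel \<partial>lborel)"
    by (rule lborel_pair.Fubini') measurable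
  also have "\<dots> = (\<integral>\<^sup>+t. \<integral>\<^sup>+s. h (Complex (exp s * t) (exp s)) \<partial>lborel \<partial>lborel)"
    by (rule nn_integral_cong, subst nn_integral_exp_substitution[symmetric])
      (auto simp: mult_ac)
  finally show ?thesis .
qed

definition hyp_preserving :: "(complex \<Rightarrow> complex) \<Rightarrow> bool" where
  "hyp_preserving g \<longleftrightarrow> g \<in> borel_measurable borel \<and>
     (\<forall>h\<in>borel_measurable borel. (\<integral>\<^sup>+z. h (g z) \<partial>hyp_measure) = (\<integral>\<^sup>+z. h z \<partial>hyp_measure))"

lemma hyp_preserving_comp:
  assumes "hyp_preserving f" "hyp_preserving g" shows "hyp_preserving (\<lambda>z. f (g z))"
  unfolding hyp_preserving_def
proof safe
  have [measurable]: "f \<in> borel_measurable borel" "g \<in> borel_measurable borel"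
    using assms by (auto simp: hyp_preserving_def)
  show "(\<lambda>z. f (g z)) \<in> borel_measurable borel" by measurable
  fix h :: "complex \<Rightarrow> ennreal" assume [measurable]: "h \<in> borel_measurable borel"
  have "(\<lambda>z. h (f z)) \<in> borel_measurable borel" by measurable
  with assms(2) have "(\<integral>\<^sup>+z. h (f (g z)) \<partial>hyp_measure) = (\<integral>\<^sup>+z. h (f z) \<partial>hyp_measure)"
    unfolding hyp_preserving_def by (elim conjE ballE) auto
  also have "\<dots> = (\<integral>\<^sup>+z. h z \<partial>hyp_measure)"
    using assms(1) \<open>h \<in> _\<close> unfolding hyp_preserving_def by (elim conjE ballE) auto
  finally show "(\<integral>\<^sup>+z. h (f (g z)) \<partial>hyp_measure) = (\<integral>\<^sup>+z. h z \<partial>hyp_measure)" .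
qed

lemma hyp_preserving_translation: "hyp_preserving (\<lambda>z. z + of_real x)"
  unfolding hyp_preserving_def
proof safe
  fix h :: "complex \<Rightarrow> ennreal" assume [measurable]: "h \<in> borel_measurable borel"
  have "(\<integral>\<^sup>+z. h z \<partial>hyp_measure) = (\<integral>\<^sup>+z. ennreal (indicator uhp z / (Im z)\<^sup>2) * h z \<partial>lborel)"
    unfolding hyp_measure_def by (subst nn_integral_density) auto
  also have "\<dots> = (\<integral>\<^sup>+z. ennreal (indicator uhp (of_real x + z) / (Im (of_real x + z))\<^sup>2) *
      h (of_real x + z) \<partial>lborel)"
    by (subst lborel_distr_plus[of "of_real x", symmetric], subst nn_integral_distr) auto
  also have "\<dots> = (\<integral>\<^sup>+z. h (z + of_real x) \<partial>hyp_measure)"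
    unfolding hyp_measure_def by (subst nn_integral_density) (auto simp: indicator_def add.commute)
  finally show "(\<integral>\<^sup>+z. h (z + of_real x) \<partial>hyp_measure) = (\<integral>\<^sup>+z. h z \<partial>hyp_measure)" ..
qed measurable

lemma hyp_preserving_scaling:
  assumes "r > 0" shows "hyp_preserving (\<lambda>z. of_real r * z)"
  unfolding hyp_preserving_def
proof safe
  fix h :: "complex \<Rightarrow> ennreal" assume [measurable]: "h \<in> borel_measurable borel"
  have [measurable]: "(\<lambda>p. Complex (f p) (g p)) \<in> borel_measurable M"
    if "f \<in> borel_measurable M" "g \<in> borel_measurable M" for M :: "'z measure" and f g
    using that unfolding Complex_eq by measurable
  have "(\<integral>\<^sup>+s. h (of_real r * Complex (exp s * t) (exp s)) \<partial>lborel) =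
      (\<integral>\<^sup>+s. h (Complex (exp s * t) (exp s)) \<partial>lborel)" for t
    using assms by (subst (2) nn_integral_real_affine[where c = 1 and t = "ln r"])
      (auto simp: exp_add complex_eq_iff intro!: nn_integral_cong arg_cong[of _ _ h])
  thus "(\<integral>\<^sup>+z. h (of_real r * z) \<partial>hyp_measure) = (\<integral>\<^sup>+z. h z \<partial>hyp_measure)"
    by (simp add: nn_integral_hyp_measure)
qed measurable

lemma hyp_preserving_inversion: "hyp_preserving (\<lambda>z. - 1 / z)"
  unfolding hyp_preserving_def
proof safe
  fix h :: "complex \<Rightarrow> ennreal" assume [measurable]: "h \<in> borel_measurable borel"
  have [measurable]: "(\<lambda>p. Complex (f p) (g p)) \<in> borel_measurable M"
    if "f \<in> borel_measurable M" "g \<in> borel_measurable M" for M :: "'z measure" and f g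
    using that unfolding Complex_eq by measurable
  \<comment> \<open>For z = exp s (t + i), the square of the absolute value is exp(2 s) (1 + t^2).
    So -1/z has imaginary part exp(-s)/(1 + t^2), and the ratio t of real to imaginary part changes
    sign.\<close>
  have *: "- 1 / Complex (exp s * t) (exp s) =
      Complex (exp (- ln (1 + t\<^sup>2) - s) * - t) (exp (- ln (1 + t\<^sup>2) - s))" for s t
  proof -
    have t: "1 + t\<^sup>2 > 0" by (smt (verit) zero_le_power2)
    have e: "exp (- ln (1 + t\<^sup>2) - s) = 1 / ((1 + t\<^sup>2) * exp s)"
      using t by (simp add: exp_diff exp_minus field_simps)
    have "Complex (exp s * t) (exp s) \<noteq> 0" by (auto simp: complex_eq_iff)
    moreover have "Complex (exp (- ln (1 + t\<^sup>2) - s) * - t) (exp (- ln (1 + t\<^sup>2) - s)) *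
        Complex (exp s * t) (exp s) = - 1"
      unfolding e using t
      by (simp add: complex_eq_iff divide_simps) (simp add: algebra_simps power2_eq_square)
    ultimately show ?thesis using nonzero_divide_eq_eq by metis
  qed
  have "(\<integral>\<^sup>+z. h (- 1 / z) \<partial>hyp_measure) = (\<integral>\<^sup>+t. \<integral>\<^sup>+s. h (- 1 / Complex (exp s * t) (exp s)) \<partial>lborel \<partial>lborel)"
    by (subst nn_integral_hyp_measure) auto
  also have "\<dots> = (\<integral>\<^sup>+t. \<integral>\<^sup>+s. h (Complex (exp s * - t) (exp s)) \<partial>lborel \<partial>lborel)"
  proof (rule nn_integral_cong)
    fix t :: real
    show "(\<integral>\<^sup>+s. h (- 1 / Complex (exp s * t) (exp s)) \<partial>lborel) =
        (\<integral>\<^sup>+s. h (Complex (exp s * - t) (exp s)) \<partial>lborel)"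
      unfolding * by (subst (2) nn_integral_real_affine[where c = "-1" and t = "- ln (1 + t\<^sup>2)"]) auto
  qed
  also have "\<dots> = (\<integral>\<^sup>+t. \<integral>\<^sup>+s. h (Complex (exp s * t) (exp s)) \<partial>lborel \<partial>lborel)"
    by (subst (2) nn_integral_real_affine[where c = "-1" and t = 0]) auto
  finally show "(\<integral>\<^sup>+z. h (- 1 / z) \<partial>hyp_measure) = (\<integral>\<^sup>+z. h z \<partial>hyp_measure)"
    by (simp add: nn_integral_hyp_measure)
qed measurable

lemma act_measurable [measurable]: "act A \<in> borel_measurable borel"
  unfolding act_def autf_def by measurable

lemma autf_measurable [measurable]: "autf A \<in> borel_measurable borel"
  unfolding autf_def by measurable

text \<open>Bruhat decomposition: on the half-plane a matrix acts as an affine map, or as an affine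
  map, the inversion and a translation. Determinants other than one are included because diag(1, d)
  is used as a change of variables.\<close>

lemma nn_integral_act:
  assumes "det A > 0" and h [measurable]: "h \<in> borel_measurable borel"
  shows "(\<integral>\<^sup>+z. h (act A z) \<partial>hyp_measure) = (\<integral>\<^sup>+z. h z \<partial>hyp_measure)"
proof -
  obtain a b c d where A: "A = mat2 a b c d" by (rule mat2_cases)
  have det: "a * d - b * c > 0" using assms(1) A by simp
  obtain g where g: "hyp_preserving g" "\<And>z. Im z > 0 \<Longrightarrow> act A z = g z"
  proof (cases "c = 0")
    case True
    hence "of_int a / of_int d > (0 :: real)" using det
      by (auto simp: zero_less_divide_iff zero_less_mult_iff)
    hence "hyp_preserving (\<lambda>z. of_real (of_int a / of_int d) * z + of_real (of_int b / of_int d))"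
      by (intro hyp_preserving_comp[OF hyp_preserving_translation] hyp_preserving_scaling)
    thus ?thesis by (rule that) (simp add: A True add_divide_distrib)
  next
    case False
    \<comment> \<open>The constants come from (a z + b)/(c z + d) = a/c - D/(c (c z + d)).\<close>
    define D :: real where "D = of_int (a * d - b * c)"
    have D: "D > 0" unfolding D_def using det by linarith
    have "hyp_preserving (\<lambda>z. - 1 / (of_real (of_int c ^ 2 / D) * (z + of_real (of_int d / of_int c)))
        + of_real (of_int a / of_int c))"
      using False D by (intro hyp_preserving_comp[OF hyp_preserving_translation]
          hyp_preserving_comp[OF hyp_preserving_inversion]
          hyp_preserving_comp[OF hyp_preserving_scaling hyp_preserving_translation]) auto
    moreover have "act A z = - 1 / (of_real (of_int c ^ 2 / D) * (z + of_real (of_int d / of_int c)))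
        + of_real (of_int a / of_int c)" if z: "Im z > 0" for z
    proof -
      have nz: "of_int c * z + of_int d \<noteq> 0" using autf_nonzero[of A z] z det A by simp
      define u where "u = of_int c * z + of_int d"
      have "of_real (of_int c ^ 2 / D) * (z + of_real (of_int d / of_int c)) =
          of_int c * u / of_real D"
        using False D by (simp add: u_def divide_simps power2_eq_square)
      moreover have "act A z = (of_int a * u - of_real D) / (of_int c * u)"
        using False nz unfolding A act_mat2 u_def D_def
        by (simp add: divide_simps) (simp add: algebra_simps)
      ultimately show ?thesis using nz False D unfolding u_def[symmetric]
        by (simp only:) (simp add: divide_simps)
    qed
    ultimately show ?thesis by (rule that)
  qed
  have "(\<integral>\<^sup>+z. h (act A z) \<partial>hyp_measure) = (\<integral>\<^sup>+z. h (g z) \<partial>hyp_measure)"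
    by (rule nn_integral_cong_AE) (use AE_hyp_measure in eventually_elim, simp add: g)
  thus ?thesis using g h by (simp add: hyp_preserving_def)
qed

subsection \<open>Fundamental sets and unfolding\<close>

abbreviation neg_one :: "int^2^2" where "neg_one \<equiv> mat2 (- 1) 0 0 (- 1)"

text \<open>Closure under \<open>adj\<close> is closure under inverses. Minus the identity is
  required so that a point with trivial stabilizer modulo sign meets a fundamental set exactly
  twice, whatever the group.\<close>

definition modular_group :: "(int^2^2) set \<Rightarrow> bool" where
  "modular_group G \<longleftrightarrow> G \<subseteq> SL2Z \<and> mat 1 \<in> G \<and> neg_one \<in> G \<and>
     (\<forall>A\<in>G. adj A \<in> G) \<and> (\<forall>A\<in>G. \<forall>B\<in>G. A ** B \<in> G)"

text \<open>\<open>fundamental_set\<close> for an arbitrary group, needed because unfolding also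
  uses conjugates of \<open>Gamma0\<close>.\<close>

definition fundamental_for :: "(int^2^2) set \<Rightarrow> complex set \<Rightarrow> bool" where
  "fundamental_for G F \<longleftrightarrow> F \<in> sets borel \<and> F \<subseteq> uhp \<and>
     (\<forall>z\<in>uhp. \<exists>!w. w \<in> F \<and> (\<exists>A\<in>G. w = act A z))"

lemma modular_groupD:
  assumes "modular_group G"
  shows "A \<in> G \<Longrightarrow> A \<in> SL2Z" "mat 1 \<in> G" "neg_one \<in> G" "A \<in> G \<Longrightarrow> adj A \<in> G"
    "A \<in> G \<Longrightarrow> B \<in> G \<Longrightarrow> A ** B \<in> G"
  using assms unfolding modular_group_def by auto

text \<open>Twice the hyperbolic cosine of the distance to \<open>\<i>\<close>.\<close>

definition cosh_dist :: "complex \<Rightarrow> real" where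
  "cosh_dist w = ((cmod w)\<^sup>2 + 1) / Im w"

text \<open>The right-hand side is a positive definite quadratic form in the rows of A, which makes
  the matrices with bounded value finite in number.\<close>

lemma cosh_dist_act:
  assumes "det A = 1" "Im z > 0" and A: "A = mat2 a b c d"
  shows "cosh_dist (act A z) = ((cmod (of_int a * z + of_int b))\<^sup>2 + (cmod (of_int c * z + of_int d))\<^sup>2) / Im z"
proof -
  have nz: "of_int c * z + of_int d \<noteq> 0"
    using autf_nonzero[of A z] assms by simp
  have im: "Im (act A z) = Im z / (cmod (of_int c * z + of_int d))\<^sup>2"
    unfolding Im_act assms(1) by (simp add: A)
  show ?thesis using assms(2) nz
    unfolding cosh_dist_def im by (simp add: norm_divide A power_divide divide_simps)
qed

lemma finite_cosh_dist_le:
  assumes z: "Im z > 0"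
  shows "finite {A \<in> SL2Z. cosh_dist (act A z) \<le> C}"
proof -
  define R where "R = sqrt (C * Im z)"
  \<comment> \<open>If |a z + b| is at most R, the imaginary part gives |a| <= R / Im z, and the
    triangle inequality gives |b| <= R + |a| |z|. The sum of the two bounds dominates both.\<close>
  define K where "K = \<lceil>R / Im z + R + R / Im z * cmod z\<rceil>"
  have row: "\<bar>a\<bar> \<le> K \<and> \<bar>b\<bar> \<le> K" if "(cmod (of_int a * z + of_int b))\<^sup>2 \<le> C * Im z" for a b
  proof -
    have le: "cmod (of_int a * z + of_int b) \<le> R"
      unfolding R_def using that by (simp add: real_le_rsqrt)
    have "\<bar>Im (of_int a * z + of_int b)\<bar> \<le> R"
      using abs_Im_le_cmod le order_trans by blast
    hence a: "\<bar>real_of_int a\<bar> \<le> R / Im z"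
      using z by (simp add: abs_mult le_divide_eq)
    have "cmod (of_int b) \<le> cmod (of_int a * z + of_int b) + cmod (of_int a * z)"
      using norm_triangle_ineq4[of "of_int a * z + of_int b" "of_int a * z"] by simp
    also have "\<dots> \<le> R + R / Im z * cmod z"
      using le mult_right_mono[OF a, of "cmod z"] by (simp add: norm_mult)
    finally have b: "\<bar>real_of_int b\<bar> \<le> R + R / Im z * cmod z" by simp
    have "0 \<le> R / Im z" "0 \<le> R + R / Im z * cmod z" using a b by linarith+
    with a b have "\<bar>real_of_int a\<bar> \<le> of_int K" "\<bar>real_of_int b\<bar> \<le> of_int K"
      unfolding K_def by linarith+
    thus ?thesis by linarith
  qed
  have "{A \<in> SL2Z. cosh_dist (act A z) \<le> C} \<subseteq>
      (\<lambda>(a, b, c, d). mat2 a b c d) ` ({-K..K} \<times> {-K..K} \<times> {-K..K} \<times> {-K..K})"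
  proof safe
    fix A assume A: "A \<in> SL2Z" "cosh_dist (act A z) \<le> C"
    obtain a b c d where abcd: "A = mat2 a b c d" by (rule mat2_cases)
    have "(cmod (of_int a * z + of_int b))\<^sup>2 + (cmod (of_int c * z + of_int d))\<^sup>2 \<le> C * Im z"
      using A cosh_dist_act[OF _ z abcd] z by (simp add: divide_le_eq)
    hence "(cmod (of_int a * z + of_int b))\<^sup>2 \<le> C * Im z" "(cmod (of_int c * z + of_int d))\<^sup>2 \<le> C * Im z"
      by (smt (verit) zero_le_power2)+
    from row[OF this(1)] row[OF this(2)]
    show "A \<in> (\<lambda>(a, b, c, d). mat2 a b c d) ` ({-K..K} \<times> {-K..K} \<times> {-K..K} \<times> {-K..K})"
      unfolding abcd by (intro image_eqI[of _ _ "(a, b, c, d)"]) auto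
  qed
  thus ?thesis by (rule finite_subset) auto
qed

text \<open>The least element of an orbit for the following total order serves as its representative.\<close>

definition orbit_le :: "complex \<Rightarrow> complex \<Rightarrow> bool" where
  "orbit_le w w' \<longleftrightarrow> cosh_dist w < cosh_dist w' \<or> cosh_dist w = cosh_dist w' \<and>
     (Re w < Re w' \<or> Re w = Re w' \<and> Im w \<le> Im w')"

lemma orbit_le_finite_min:
  assumes "finite O'" "O' \<noteq> {}"
  shows "\<exists>w\<in>O'. \<forall>w'\<in>O'. orbit_le w w'"
  using assms
proof (induction rule: finite_ne_induct)
  case (insert x F)
  then obtain w where w: "w \<in> F" "\<And>w'. w' \<in> F \<Longrightarrow> orbit_le w w'" by blast
  have refl: "orbit_le y y" for y by (simp add: orbit_le_def)
  have trans: "orbit_le a b \<Longrightarrow> orbit_le b c \<Longrightarrow> orbit_le a c" for a b c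
    unfolding orbit_le_def by auto
  have "orbit_le x w \<or> orbit_le w x" unfolding orbit_le_def by auto
  thus ?case
  proof
    assume "orbit_le x w"
    thus ?thesis using w refl trans by (intro bexI[of _ x]) auto
  next
    assume "orbit_le w x"
    thus ?thesis using w refl trans by (intro bexI[of _ w]) auto
  qed
qed (auto simp: orbit_le_def)

text \<open>Only finitely many group elements send z to a point with \<open>cosh_dist\<close> at
  most that of z, so every orbit has a least point for \<open>orbit_le\<close>. Being least is one
  Borel condition for each of countably many matrices, so the set of least points is Borel.\<close>

lemma fundamental_for_exists:
  assumes G: "modular_group G"
  shows "\<exists>F. fundamental_for G F"
proof -
  note GD = modular_groupD[OF G]
  define F where "F = {z \<in> uhp. \<forall>A\<in>G. orbit_le z (act A z)}"
  have [measurable]: "cosh_dist \<in> borel_measurable borel"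
    unfolding cosh_dist_def by measurable
  have "{z. orbit_le z (act A z)} \<in> sets borel" for A
  proof -
    have "Measurable.pred borel (\<lambda>z. orbit_le z (act A z))"
      unfolding orbit_le_def by measurable
    thus ?thesis by (simp add: pred_def)
  qed
  hence "(\<Inter>A\<in>G. {z. orbit_le z (act A z)}) \<in> sets borel"
    using GD(2) by (intro sets.countable_INT'') auto
  moreover have "F = uhp \<inter> (\<Inter>A\<in>G. {z. orbit_le z (act A z)})"
    by (auto simp: F_def)
  ultimately have "F \<in> sets borel" by simp
  moreover have "\<exists>!w. w \<in> F \<and> (\<exists>A\<in>G. w = act A z)" if z: "z \<in> uhp" for z
  proof -
    define O' where "O' = (\<lambda>A. act A z) ` {A \<in> G. cosh_dist (act A z) \<le> cosh_dist z}"
    have "finite {A \<in> G. cosh_dist (act A z) \<le> cosh_dist z}"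
      by (rule finite_subset[OF _ finite_cosh_dist_le[of z "cosh_dist z"]]) (use GD z in auto)
    hence "finite O'" by (simp add: O'_def)
    moreover have "z \<in> O'"
      unfolding O'_def using GD(2) by (intro image_eqI[of _ _ "mat 1"]) auto
    ultimately obtain w where w: "w \<in> O'" "\<And>w'. w' \<in> O' \<Longrightarrow> orbit_le w w'"
      using orbit_le_finite_min[of O'] by blast
    then obtain A where A: "A \<in> G" "w = act A z" "cosh_dist w \<le> cosh_dist z"
      by (auto simp: O'_def)
    have "w \<in> F" unfolding F_def
    proof safe
      show wu: "w \<in> uhp" using A z GD act_uhp by simp
      fix B assume B: "B \<in> G"
      have eq: "act B w = act (B ** A) z" using A B z GD by (simp add: act_mult)
      show "orbit_le w (act B w)"
      proof (cases "cosh_dist (act B w) \<le> cosh_dist z")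
        case True
        hence "act B w \<in> O'" using A B GD unfolding O'_def eq by blast
        thus ?thesis using w by blast
      next
        case False
        thus ?thesis using A by (auto simp: orbit_le_def)
      qed
    qed
    have uniq: "w' = w" if w': "w' \<in> F" "w' = act B z" "B \<in> G" for w' B
    proof -
      have "w' = act (B ** adj A) w" "w = act (A ** adj B) w'"
        using A w' z GD by (simp_all add: act_mult act_uhp act_adj)
      moreover have "orbit_le w (act (B ** adj A) w)" "orbit_le w' (act (A ** adj B) w')"
        using \<open>w \<in> F\<close> w'(1,3) A(1) GD(4,5) unfolding F_def by blast+
      ultimately have "orbit_le w w'" "orbit_le w' w" by argo+
      thus ?thesis by (auto simp: orbit_le_def complex_eq_iff)
    qed
    show ?thesis
    proof (rule ex1I[of _ w])
      show "w \<in> F \<and> (\<exists>A\<in>G. w = act A z)" using \<open>w \<in> F\<close> A by blast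
      show "w' = w" if "w' \<in> F \<and> (\<exists>A\<in>G. w' = act A z)" for w'
        using that uniq[of w'] by (elim conjE bexE)
    qed
  qed
  ultimately show ?thesis unfolding fundamental_for_def by (intro exI[of _ F]) (auto simp: F_def)
qed

text \<open>Points with a stabilizer in \<open>SL2Z\<close> larger than plus and minus one; taking
  all of \<open>SL2Z\<close> gives one null set that serves every subgroup.\<close>

definition elliptic :: "complex set" where
  "elliptic = {z. Im z > 0 \<and> (\<exists>A\<in>SL2Z. A \<noteq> mat 1 \<and> A \<noteq> neg_one \<and> act A z = z)}"

text \<open>A fixed point is a root of c z^2 + (d - a) z - b, which is the zero polynomial only for
  scalar matrices, and there are countably many matrices.\<close>

lemma countable_elliptic: "countable elliptic"
proof -
  have "countable {z. Im z > 0 \<and> act A z = z}" if A: "A \<in> SL2Z" "A \<noteq> mat 1" "A \<noteq> neg_one" for A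
  proof -
    obtain a b c d where abcd: "A = mat2 a b c d" "a * d - b * c = 1" using SL2Z_cases[OF A(1)] .
    define p :: "complex poly" where "p = [:- of_int b, of_int d - of_int a, of_int c:]"
    have "p \<noteq> 0"
    proof
      assume "p = 0"
      hence "b = 0" "a = d" "c = 0" by (auto simp: p_def)
      moreover from this have "a = 1 \<or> a = - 1" using abcd zmult_eq_1_iff by auto
      ultimately show False using A abcd by (auto simp: mat_1_mat2)
    qed
    moreover have "{z. Im z > 0 \<and> act A z = z} \<subseteq> {z. poly p z = 0}"
    proof safe
      fix z assume z: "Im z > 0" "act A z = z"
      have "of_int c * z + of_int d \<noteq> 0" using autf_nonzero[of A z] z abcd by simp
      with z(2) have "of_int a * z + of_int b = z * (of_int c * z + of_int d)"
        unfolding abcd(1) act_mat2 by (simp add: divide_eq_eq)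
      thus "poly p z = 0" by (simp add: p_def algebra_simps)
    qed
    ultimately show ?thesis using poly_roots_finite finite_subset countable_finite by metis
  qed
  hence "countable (\<Union>A\<in>{A \<in> SL2Z. A \<noteq> mat 1 \<and> A \<noteq> neg_one}. {z. Im z > 0 \<and> act A z = z})"
    by (intro countable_UN) auto
  thus ?thesis by (rule countable_subset[rotated]) (auto simp: elliptic_def)
qed

lemma AE_not_elliptic: "AE z in hyp_measure. z \<notin> elliptic"
proof -
  have "AE z in lborel. z \<notin> elliptic"
    by (rule AE_not_in[OF countable_imp_null_set_lborel[OF countable_elliptic]])
  thus ?thesis unfolding hyp_measure_def by (subst AE_density) auto
qed

text \<open>The factor two counts a matrix and its negative.\<close>

lemma nn_integral_orbit_count:
  assumes G: "modular_group G" and F: "fundamental_for G F"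
    and z: "Im z > 0" "z \<notin> elliptic"
  shows "(\<integral>\<^sup>+A. indicator F (act A z) \<partial>count_space G) = 2"
proof -
  note GD = modular_groupD[OF G]
  obtain A where A: "A \<in> G" "act A z \<in> F"
    using F z unfolding fundamental_for_def by (metis uhp_iff)
  define A' where "A' = A ** neg_one"
  have A': "A' \<in> G" "act A' z = act A z"
    using A GD z by (auto simp: A'_def act_mult)
  have "A \<noteq> A'"
    using GD(1)[OF A(1)] unfolding A'_def by (elim SL2Z_cases) (auto simp: mat2_eq_iff[of "mat2 _ _ _ _"])
  have "B = A \<or> B = A'" if B: "B \<in> G" "act B z \<in> F" for B
  proof -
    have "act B z = act A z"
      using F A B z unfolding fundamental_for_def by (metis uhp_iff)
    hence "act (adj A ** B) z = z" using A B GD z by (simp add: act_mult act_adj)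
    moreover have "adj A ** B \<in> SL2Z" using A B GD by blast
    ultimately have "adj A ** B = mat 1 \<or> adj A ** B = neg_one"
      using z unfolding elliptic_def by blast
    moreover have "B = A ** (adj A ** B)"
      using A GD by (simp add: matrix_mul_assoc adj_right)
    ultimately show ?thesis unfolding A'_def by (metis matrix_mul_rid)
  qed
  hence "{B \<in> G. act B z \<in> F} = {A, A'}" using A A' by auto
  moreover have "(\<integral>\<^sup>+A. indicator F (act A z) \<partial>count_space G) =
      (\<integral>\<^sup>+A. indicator {B \<in> G. act B z \<in> F} A \<partial>count_space G)"
    by (intro nn_integral_cong) (auto simp: indicator_def)
  ultimately have "(\<integral>\<^sup>+A. indicator F (act A z) \<partial>count_space G) = emeasure (count_space G) {A, A'}"
    using A A' by simp
  also have "\<dots> = 2" using A A' \<open>A \<noteq> A'\<close> by (simp add: emeasure_count_space)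
  finally show ?thesis .
qed

text \<open>Representatives of the cosets \<open>G' ** r i\<close>. The index set is kept apart from
  the matrices so that a sum over it counts cosets.\<close>

definition coset_reps :: "(int^2^2) set \<Rightarrow> (int^2^2) set \<Rightarrow> 'i set \<Rightarrow> ('i \<Rightarrow> int^2^2) \<Rightarrow> bool" where
  "coset_reps G G' I r \<longleftrightarrow> finite I \<and> r ` I \<subseteq> G \<and>
     (\<forall>A\<in>G. \<exists>!i. i \<in> I \<and> (\<exists>B\<in>G'. A = B ** r i))"

text \<open>Inverting all elements turns the cosets \<open>G' ** r i\<close> into the translates of
  \<open>G'\<close> by \<open>adj (r i)\<close> on the left, which therefore partition G.\<close>

lemma nn_integral_count_space_cosets:
  fixes a :: "int^2^2 \<Rightarrow> ennreal"
  assumes G: "modular_group G" and G': "modular_group G'" "G' \<subseteq> G" and r: "coset_reps G G' I r"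
  shows "(\<integral>\<^sup>+A. a A \<partial>count_space G) = (\<Sum>i\<in>I. \<integral>\<^sup>+B. a (adj (r i) ** B) \<partial>count_space G')"
proof -
  note GD = modular_groupD[OF G] and GD' = modular_groupD[OF G'(1)]
  have fin: "finite I" and rI: "i \<in> I \<Longrightarrow> r i \<in> G"
    and ex: "A \<in> G \<Longrightarrow> \<exists>i\<in>I. \<exists>B\<in>G'. A = B ** r i"
    and uniq: "\<And>B C. B ** r i \<in> G \<Longrightarrow> B ** r i = C ** r j \<Longrightarrow> i \<in> I \<Longrightarrow> j \<in> I \<Longrightarrow> B \<in> G' \<Longrightarrow> C \<in> G' \<Longrightarrow> i = j"
    for A i j
    using r unfolding coset_reps_def by blast+
  define T where "T i = (\<lambda>B. adj (r i) ** B) ` G'" for i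
  have TG: "T i \<subseteq> G" if "i \<in> I" for i
    using that rI GD G' by (auto simp: T_def)
  have one: "(\<Sum>i\<in>I. indicator (T i) A) = (1 :: ennreal)" if A: "A \<in> G" for A
  proof -
    obtain i B where i: "i \<in> I" "B \<in> G'" "adj A = B ** r i" using ex[of "adj A"] A GD by blast
    have "A = adj (r i) ** adj B" using i(3) by (metis adj_adj adj_mult)
    hence mem: "A \<in> T i" using i GD' by (auto simp: T_def)
    have only: "j = i" if j: "j \<in> I" "A \<in> T j" for j
    proof -
      obtain C where C: "C \<in> G'" "A = adj (r j) ** C" using j by (auto simp: T_def)
      hence "adj A = adj C ** r j" by (simp add: adj_mult)
      hence eq: "B ** r i = adj C ** r j" using i(3) by simp
      have "B ** r i \<in> G" "adj C \<in> G'" using C GD(4)[OF A] GD' i(3) by auto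
      from uniq[OF this(1) eq i(1) j(1) i(2) this(2)] show ?thesis ..
    qed
    have "indicator (T j) A = (if j = i then 1 else 0 :: ennreal)" if "j \<in> I" for j
      using mem only[OF that] by (cases "A \<in> T j") auto
    hence "(\<Sum>i\<in>I. indicator (T i) A) = (\<Sum>j\<in>I. if j = i then 1 else 0 :: ennreal)"
      by (intro sum.cong refl)
    thus ?thesis using i fin by simp
  qed
  have "(\<integral>\<^sup>+A. a A \<partial>count_space G) = (\<integral>\<^sup>+A. (\<Sum>i\<in>I. a A * indicator (T i) A) \<partial>count_space G)"
    by (intro nn_integral_cong) (simp add: sum_distrib_left[symmetric] one)
  also have "\<dots> = (\<Sum>i\<in>I. \<integral>\<^sup>+A. a A * indicator (T i) A \<partial>count_space G)"
    by (intro nn_integral_sum) auto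
  also have "\<dots> = (\<Sum>i\<in>I. \<integral>\<^sup>+B. a (adj (r i) ** B) \<partial>count_space G')"
  proof (rule sum.cong)
    fix i assume i: "i \<in> I"
    have inj: "inj_on (\<lambda>B. adj (r i) ** B) G'"
      by (rule inj_on_inverseI[of _ "\<lambda>B. r i ** B"])
        (use i rI GD in \<open>simp add: matrix_mul_assoc adj_right\<close>)
    have "(\<integral>\<^sup>+A. a A * indicator (T i) A \<partial>count_space G) = (\<integral>\<^sup>+A. a A \<partial>count_space (T i))"
      using TG[OF i] by (auto simp: nn_integral_count_space_indicator indicator_def intro!: nn_integral_cong)
    also have "\<dots> = (\<integral>\<^sup>+B. a (adj (r i) ** B) \<partial>count_space G')"
      unfolding T_def using inj by (intro nn_integral_bij_count_space[symmetric]) (simp add: bij_betw_def)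
    finally show "(\<integral>\<^sup>+A. a A * indicator (T i) A \<partial>count_space G) =
        (\<integral>\<^sup>+B. a (adj (r i) ** B) \<partial>count_space G')" .
  qed simp
  finally show ?thesis .
qed

text \<open>Counting replaces geometry. The factor 2 is written as the number of A in G with
  \<open>act A z\<close> in F; sum and integral are exchanged and G is split into cosets. Within a
  coset a change of variable moves the group element from F to F', where summing it gives 2 again,
  and the factors cancel.\<close>

lemma nn_integral_unfold:
  fixes \<phi> :: "complex \<Rightarrow> ennreal"
  assumes G: "modular_group G" and G': "modular_group G'" "G' \<subseteq> G" and r: "coset_reps G G' I r"
    and F: "fundamental_for G F" and F': "fundamental_for G' F'"
    and [measurable]: "\<phi> \<in> borel_measurable borel"
    and inv: "\<And>A z. A \<in> G' \<Longrightarrow> Im z > 0 \<Longrightarrow> \<phi> (act A z) = \<phi> z"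
  shows "(\<integral>\<^sup>+z. \<phi> z * indicator F' z \<partial>hyp_measure) =
    (\<Sum>i\<in>I. \<integral>\<^sup>+z. \<phi> (act (r i) z) * indicator F z \<partial>hyp_measure)"
proof -
  note GD = modular_groupD[OF G] and GD' = modular_groupD[OF G'(1)]
  have rI: "i \<in> I \<Longrightarrow> r i \<in> G" for i using r unfolding coset_reps_def by blast
  have [measurable]: "F \<in> sets borel" "F' \<in> sets borel"
    using F F' by (auto simp: fundamental_for_def)
  have "2 * (\<integral>\<^sup>+z. \<phi> z * indicator F' z \<partial>hyp_measure) = (\<integral>\<^sup>+z. 2 * (\<phi> z * indicator F' z) \<partial>hyp_measure)"
    by (rule nn_integral_cmult[symmetric]) measurable
  also have "\<dots> = (\<integral>\<^sup>+z. \<integral>\<^sup>+A. \<phi> z * indicator F' z * indicator F (act A z) \<partial>count_space G \<partial>hyp_measure)"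
  proof (rule nn_integral_cong_AE, use AE_hyp_measure AE_not_elliptic in eventually_elim)
    fix z assume z: "Im z > 0" "z \<notin> elliptic"
    show "2 * (\<phi> z * indicator F' z) =
        (\<integral>\<^sup>+A. \<phi> z * indicator F' z * indicator F (act A z) \<partial>count_space G)"
      using nn_integral_orbit_count[OF G F z] by (subst nn_integral_cmult) (auto simp: mult.commute)
  qed
  also have "\<dots> = (\<integral>\<^sup>+A. \<integral>\<^sup>+z. \<phi> z * indicator F' z * indicator F (act A z) \<partial>hyp_measure \<partial>count_space G)"
    by (rule nn_integral_count_space_nn_integral) (auto, measurable)
  also have "\<dots> = (\<Sum>i\<in>I. \<integral>\<^sup>+B. \<integral>\<^sup>+z. \<phi> z * indicator F' z * indicator F (act (adj (r i) ** B) z) \<partial>hyp_measure \<partial>count_space G')"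
    by (rule nn_integral_count_space_cosets[OF G G' r])
  also have "\<dots> = (\<Sum>i\<in>I. 2 * (\<integral>\<^sup>+z. \<phi> (act (r i) z) * indicator F z \<partial>hyp_measure))"
  proof (rule sum.cong)
    fix i assume i: "i \<in> I"
    have ri: "r i \<in> SL2Z" using rI[OF i] GD by blast
    \<comment> \<open>Substituting \<open>act (adj B) z\<close> for z leaves \<open>\<phi>\<close>
      unchanged, frees F from B and moves B into F'.\<close>
    have "(\<integral>\<^sup>+B. \<integral>\<^sup>+z. \<phi> z * indicator F' z * indicator F (act (adj (r i) ** B) z) \<partial>hyp_measure \<partial>count_space G') =
      (\<integral>\<^sup>+B. \<integral>\<^sup>+z. \<phi> z * indicator F (act (adj (r i)) z) * indicator F' (act (adj B) z) \<partial>hyp_measure \<partial>count_space G')"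
    proof (rule nn_integral_cong)
      fix B assume "B \<in> space (count_space G')"
      hence B: "B \<in> G'" "B \<in> SL2Z" using GD' by auto
      have "(\<integral>\<^sup>+z. \<phi> z * indicator F' z * indicator F (act (adj (r i) ** B) z) \<partial>hyp_measure) =
        (\<integral>\<^sup>+z. \<phi> (act (adj B) z) * indicator F' (act (adj B) z) *
          indicator F (act (adj (r i) ** B) (act (adj B) z)) \<partial>hyp_measure)"
        by (rule nn_integral_act[symmetric]) (use B in simp, measurable)
      also have "\<dots> = (\<integral>\<^sup>+z. \<phi> z * indicator F (act (adj (r i)) z) * indicator F' (act (adj B) z) \<partial>hyp_measure)"
        by (rule nn_integral_cong_AE, use AE_hyp_measure in eventually_elim)
          (use B GD' in \<open>simp add: act_mult act_uhp act_adj' inv mult_ac\<close>)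
      finally show "(\<integral>\<^sup>+z. \<phi> z * indicator F' z * indicator F (act (adj (r i) ** B) z) \<partial>hyp_measure) = \<dots>" .
    qed
    also have "\<dots> = (\<integral>\<^sup>+z. \<integral>\<^sup>+B. \<phi> z * indicator F (act (adj (r i)) z) * indicator F' (act (adj B) z) \<partial>count_space G' \<partial>hyp_measure)"
      by (rule nn_integral_count_space_nn_integral[symmetric]) (auto, measurable)
    also have "\<dots> = (\<integral>\<^sup>+z. 2 * (\<phi> z * indicator F (act (adj (r i)) z)) \<partial>hyp_measure)"
    proof (rule nn_integral_cong_AE, use AE_hyp_measure AE_not_elliptic in eventually_elim)
      fix z assume z: "Im z > 0" "z \<notin> elliptic"
      have "bij_betw adj G' G'"
        by (rule bij_betw_byWitness[of _ adj]) (use GD' in auto)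
      hence "(\<integral>\<^sup>+B. indicator F' (act (adj B) z) \<partial>count_space G') = 2"
        using nn_integral_orbit_count[OF G'(1) F' z]
          nn_integral_bij_count_space[of adj G' G' "\<lambda>A. indicator F' (act A z)"] by simp
      thus "(\<integral>\<^sup>+B. \<phi> z * indicator F (act (adj (r i)) z) * indicator F' (act (adj B) z) \<partial>count_space G') =
          2 * (\<phi> z * indicator F (act (adj (r i)) z))"
        by (subst nn_integral_cmult) (auto simp: mult.commute)
    qed
    also have "\<dots> = 2 * (\<integral>\<^sup>+z. \<phi> z * indicator F (act (adj (r i)) z) \<partial>hyp_measure)"
      by (rule nn_integral_cmult) measurable
    \<comment> \<open>Substituting \<open>act (r i) z\<close> for z undoes \<open>adj (r i)\<close>
      and returns to F itself.\<close>
    also have "(\<integral>\<^sup>+z. \<phi> z * indicator F (act (adj (r i)) z) \<partial>hyp_measure) =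
        (\<integral>\<^sup>+z. \<phi> (act (r i) z) * indicator F (act (adj (r i)) (act (r i) z)) \<partial>hyp_measure)"
      by (rule nn_integral_act[symmetric]) (use ri in simp, measurable)
    also have "\<dots> = (\<integral>\<^sup>+z. \<phi> (act (r i) z) * indicator F z \<partial>hyp_measure)"
      by (rule nn_integral_cong_AE, use AE_hyp_measure in eventually_elim) (use ri in \<open>simp add: act_adj\<close>)
    finally show "(\<integral>\<^sup>+B. \<integral>\<^sup>+z. \<phi> z * indicator F' z * indicator F (act (adj (r i) ** B) z) \<partial>hyp_measure \<partial>count_space G') =
        2 * (\<integral>\<^sup>+z. \<phi> (act (r i) z) * indicator F z \<partial>hyp_measure)" .
  qed simp
  finally have "2 * (\<integral>\<^sup>+z. \<phi> z * indicator F' z \<partial>hyp_measure) =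
    2 * (\<Sum>i\<in>I. \<integral>\<^sup>+z. \<phi> (act (r i) z) * indicator F z \<partial>hyp_measure)"
    by (simp add: sum_distrib_left)
  thus ?thesis by (subst (asm) ennreal_mult_cancel_left) auto
qed

text \<open>Unfolding the absolute value bounds a sum of nonnegative integrals, so every translate
  is integrable. Positive and negative parts are then unfolded separately, and finiteness allows
  their subtraction.\<close>

lemma set_integral_unfold_real:
  fixes \<phi> :: "complex \<Rightarrow> real"
  assumes G: "modular_group G" and G': "modular_group G'" "G' \<subseteq> G" and r: "coset_reps G G' I r"
    and F: "fundamental_for G F" and F': "fundamental_for G' F'"
    and meas [measurable]: "\<phi> \<in> borel_measurable borel"
    and inv: "\<And>A z. A \<in> G' \<Longrightarrow> Im z > 0 \<Longrightarrow> \<phi> (act A z) = \<phi> z"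
    and int: "set_integrable hyp_measure F' \<phi>"
  shows "\<And>i. i \<in> I \<Longrightarrow> set_integrable hyp_measure F (\<lambda>z. \<phi> (act (r i) z))"
    and "(LINT z:F'|hyp_measure. \<phi> z) = (\<Sum>i\<in>I. LINT z:F|hyp_measure. \<phi> (act (r i) z))"
proof -
  have fin: "finite I" using r by (simp add: coset_reps_def)
  have [measurable]: "F \<in> sets borel" "F' \<in> sets borel"
    using F F' by (auto simp: fundamental_for_def)
  have unfold: "(\<integral>\<^sup>+z. ennreal (indicator F' z *\<^sub>R \<psi> z) \<partial>hyp_measure) =
      (\<Sum>i\<in>I. \<integral>\<^sup>+z. ennreal (indicator F z *\<^sub>R \<psi> (act (r i) z)) \<partial>hyp_measure)"
    if [measurable]: "\<psi> \<in> borel_measurable borel"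
      and "\<And>A z. A \<in> G' \<Longrightarrow> Im z > 0 \<Longrightarrow> \<psi> (act A z) = \<psi> z" for \<psi> :: "complex \<Rightarrow> real"
  proof -
    have "ennreal (indicator E z *\<^sub>R \<psi> w) = ennreal (\<psi> w) * indicator E z" for E and z w :: complex
      by (auto simp: indicator_def)
    moreover have "(\<lambda>z. ennreal (\<psi> z)) \<in> borel_measurable borel" by measurable
    ultimately show ?thesis
      using nn_integral_unfold[OF G G' r F F', of "\<lambda>z. ennreal (\<psi> z)"] that(2) by simp
  qed
  have fin': "(\<Sum>i\<in>I. \<integral>\<^sup>+z. ennreal (indicator F z *\<^sub>R \<bar>\<phi> (act (r i) z)\<bar>) \<partial>hyp_measure) < \<infinity>"
  proof -
    have "(\<integral>\<^sup>+z. ennreal (indicator F' z *\<^sub>R \<bar>\<phi> z\<bar>) \<partial>hyp_measure) < \<infinity>"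
      using int unfolding set_integrable_def integrable_iff_bounded by (simp add: abs_mult)
    thus ?thesis by (subst (asm) unfold) (use inv in auto)
  qed
  show int': "set_integrable hyp_measure F (\<lambda>z. \<phi> (act (r i) z))" if "i \<in> I" for i
  proof -
    have "(\<integral>\<^sup>+z. ennreal (indicator F z *\<^sub>R \<bar>\<phi> (act (r i) z)\<bar>) \<partial>hyp_measure) < \<infinity>"
      using fin' fin that by (simp add: sum_nonneg less_top)
    thus ?thesis unfolding set_integrable_def integrable_iff_bounded
      by (simp add: abs_mult) measurable
  qed
  have lt: "(\<integral>\<^sup>+z. ennreal (indicator F z *\<^sub>R \<phi> (act (r i) z)) \<partial>hyp_measure) < top"
    "(\<integral>\<^sup>+z. ennreal (- (indicator F z *\<^sub>R \<phi> (act (r i) z))) \<partial>hyp_measure) < top" if "i \<in> I" for i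
    using int'[OF that] unfolding set_integrable_def real_integrable_def by (auto simp: less_top)
  have "(LINT z:F'|hyp_measure. \<phi> z) =
      enn2real (\<integral>\<^sup>+z. ennreal (indicator F' z *\<^sub>R \<phi> z) \<partial>hyp_measure) -
      enn2real (\<integral>\<^sup>+z. ennreal (indicator F' z *\<^sub>R (- \<phi> z)) \<partial>hyp_measure)"
    using int unfolding set_integrable_def set_lebesgue_integral_def
    by (subst real_lebesgue_integral_def) auto
  also have "\<dots> = (\<Sum>i\<in>I. enn2real (\<integral>\<^sup>+z. ennreal (indicator F z *\<^sub>R \<phi> (act (r i) z)) \<partial>hyp_measure)) -
      (\<Sum>i\<in>I. enn2real (\<integral>\<^sup>+z. ennreal (- (indicator F z *\<^sub>R \<phi> (act (r i) z))) \<partial>hyp_measure))"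
    by (subst (1 2) unfold) (use inv lt in \<open>auto simp: enn2real_sum o_def\<close>)
  also have "\<dots> = (\<Sum>i\<in>I. LINT z:F|hyp_measure. \<phi> (act (r i) z))"
    unfolding sum_subtractf[symmetric] set_lebesgue_integral_def
    by (intro sum.cong refl real_lebesgue_integral_def[symmetric])
      (use int' in \<open>simp add: set_integrable_def\<close>)
  finally show "(LINT z:F'|hyp_measure. \<phi> z) = (\<Sum>i\<in>I. LINT z:F|hyp_measure. \<phi> (act (r i) z))" .
qed

section \<open>Complex-valued integrands\<close>

lemma set_integrable_complex_iff:
  "set_integrable M A (f :: 'a \<Rightarrow> complex) \<longleftrightarrow>
    set_integrable M A (\<lambda>x. Re (f x)) \<and> set_integrable M A (\<lambda>x. Im (f x))"
proof safe
  assume "set_integrable M A (\<lambda>x. Re (f x))" "set_integrable M A (\<lambda>x. Im (f x))"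
  hence "integrable M (\<lambda>x. of_real (indicator A x *\<^sub>R Re (f x)) + \<i> * of_real (indicator A x *\<^sub>R Im (f x)))"
    unfolding set_integrable_def
    by (intro Bochner_Integration.integrable_add integrable_mult_right complex_of_real_integrable_eq[THEN iffD2])
  also have "(\<lambda>x. of_real (indicator A x *\<^sub>R Re (f x)) + \<i> * of_real (indicator A x *\<^sub>R Im (f x))) =
      (\<lambda>x. indicator A x *\<^sub>R f x)"
    by (auto simp: fun_eq_iff complex_eq_iff)
  finally show "set_integrable M A f" by (simp add: set_integrable_def)
next
  assume f: "set_integrable M A f"
  show "set_integrable M A (\<lambda>x. Re (f x))" "set_integrable M A (\<lambda>x. Im (f x))"
    using integrable_Re[OF f[unfolded set_integrable_def]] integrable_Im[OF f[unfolded set_integrable_def]]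
    by (simp_all add: set_integrable_def)
qed

lemma set_integral_complex:
  assumes "set_integrable M A (f :: 'a \<Rightarrow> complex)"
  shows "(LINT x:A|M. f x) = Complex (LINT x:A|M. Re (f x)) (LINT x:A|M. Im (f x))"
  using integral_Re[OF assms[unfolded set_integrable_def]] integral_Im[OF assms[unfolded set_integrable_def]]
  unfolding set_lebesgue_integral_def by (simp add: complex_eq_iff del: integral_Re integral_Im)

lemma set_integral_unfold:
  fixes \<phi> :: "complex \<Rightarrow> complex"
  assumes G: "modular_group G" and G': "modular_group G'" "G' \<subseteq> G" and r: "coset_reps G G' I r"
    and F: "fundamental_for G F" and F': "fundamental_for G' F'"
    and [measurable]: "\<phi> \<in> borel_measurable borel"
    and inv: "\<And>A z. A \<in> G' \<Longrightarrow> Im z > 0 \<Longrightarrow> \<phi> (act A z) = \<phi> z"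
    and int: "set_integrable hyp_measure F' \<phi>"
  shows "\<And>i. i \<in> I \<Longrightarrow> set_integrable hyp_measure F (\<lambda>z. \<phi> (act (r i) z))"
    and "(LINT z:F'|hyp_measure. \<phi> z) = (\<Sum>i\<in>I. LINT z:F|hyp_measure. \<phi> (act (r i) z))"
proof -
  have int': "set_integrable hyp_measure F' (\<lambda>z. Re (\<phi> z))" "set_integrable hyp_measure F' (\<lambda>z. Im (\<phi> z))"
    using int by (auto simp: set_integrable_complex_iff[of _ _ \<phi>])
  have "(\<lambda>z. Re (\<phi> z)) \<in> borel_measurable borel" "(\<lambda>z. Im (\<phi> z)) \<in> borel_measurable borel" by measurable
  note re = set_integral_unfold_real[OF G G' r F F' this(1) _ int'(1)]
    and im = set_integral_unfold_real[OF G G' r F F' this(2) _ int'(2)]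
  show int'': "set_integrable hyp_measure F (\<lambda>z. \<phi> (act (r i) z))" if "i \<in> I" for i
    using re(1)[OF _ that] im(1)[OF _ that] inv
    by (simp add: set_integrable_complex_iff[of _ _ "\<lambda>z. \<phi> (act (r i) z)"])
  show "(LINT z:F'|hyp_measure. \<phi> z) = (\<Sum>i\<in>I. LINT z:F|hyp_measure. \<phi> (act (r i) z))"
    using re(2) im(2) inv int int''
    by (simp add: set_integral_complex complex_eq_iff)
qed

lemma distr_hyp_measure: "det A > 0 \<Longrightarrow> distr hyp_measure borel (act A) = hyp_measure"
proof (rule measure_eqI)
  fix X assume "det A > 0" "X \<in> sets (distr hyp_measure borel (act A))"
  moreover from this have [measurable]: "X \<in> sets borel" by simp
  ultimately show "emeasure (distr hyp_measure borel (act A)) X = emeasure hyp_measure X"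
    using nn_integral_act[of A "indicator X"] nn_integral_distr[of "act A" hyp_measure borel "indicator X"]
    by simp
qed simp

lemma set_integral_act:
  fixes \<phi> :: "complex \<Rightarrow> complex"
  assumes A: "det A > 0" and [measurable]: "\<phi> \<in> borel_measurable borel" "F \<in> sets borel"
  shows "(LINT z:act A -` F|hyp_measure. \<phi> (act A z)) = (LINT z:F|hyp_measure. \<phi> z)"
    and "set_integrable hyp_measure (act A -` F) (\<lambda>z. \<phi> (act A z)) \<longleftrightarrow> set_integrable hyp_measure F \<phi>"
proof -
  have *: "indicator (act A -` F) z *\<^sub>R \<phi> (act A z) = (\<lambda>w. indicator F w *\<^sub>R \<phi> w) (act A z)" for z
    by (simp add: indicator_def)
  show "(LINT z:act A -` F|hyp_measure. \<phi> (act A z)) = (LINT z:F|hyp_measure. \<phi> z)"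
    unfolding set_lebesgue_integral_def *
    by (subst (2) distr_hyp_measure[OF A, symmetric], subst integral_distr) auto
  show "set_integrable hyp_measure (act A -` F) (\<lambda>z. \<phi> (act A z)) \<longleftrightarrow> set_integrable hyp_measure F \<phi>"
    unfolding set_integrable_def *
    by (subst (2) distr_hyp_measure[OF A, symmetric], subst integrable_distr_eq) auto
qed

subsection \<open>Congruence subgroups and cosets\<close>

text \<open>The group Gamma_0(l) intersected with Gamma^0(d). Conjugation by diag(1, d) takes it to
  \<open>Gamma0 (l * d)\<close>, while it is itself a subgroup of \<open>Gamma0 l\<close>.\<close>

definition Gamma00 :: "nat \<Rightarrow> nat \<Rightarrow> (int^2^2) set" where
  "Gamma00 l d = {A \<in> SL2Z. int l dvd A $ 2 $ 1 \<and> int d dvd A $ 1 $ 2}"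

lemma Gamma00_1: "Gamma00 l (Suc 0) = Gamma0 l"
  by (auto simp: Gamma00_def Gamma0_def)

lemma mat2_Gamma00 [simp]:
  "mat2 a b c d' \<in> Gamma00 l d \<longleftrightarrow> a * d' - b * c = 1 \<and> int l dvd c \<and> int d dvd b"
  by (simp add: Gamma00_def mat2_SL2Z)

lemma mat2_Gamma0 [simp]:
  "mat2 a b c d' \<in> Gamma0 l \<longleftrightarrow> a * d' - b * c = 1 \<and> int l dvd c"
  by (simp add: Gamma0_def mat2_SL2Z)

lemma modular_group_Gamma00: "modular_group (Gamma00 l d)"
  unfolding modular_group_def
proof (intro conjI ballI)
  show "Gamma00 l d \<subseteq> SL2Z" by (auto simp: Gamma00_def)
  show "mat 1 \<in> Gamma00 l d" "neg_one \<in> Gamma00 l d" by (simp_all add: mat_1_mat2)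
  show "adj A \<in> Gamma00 l d" if "A \<in> Gamma00 l d" for A
    using that by (cases A rule: mat2_cases) (simp add: mult.commute)
  show "A ** B \<in> Gamma00 l d" if "A \<in> Gamma00 l d" "B \<in> Gamma00 l d" for A B
  proof -
    have "A ** B \<in> SL2Z" using that by (auto simp: Gamma00_def mult_SL2Z)
    thus ?thesis using that
      by (cases A rule: mat2_cases, cases B rule: mat2_cases) (simp add: mat2_SL2Z)
  qed
qed

lemma modular_group_Gamma0: "modular_group (Gamma0 l)"
  using modular_group_Gamma00[of l "Suc 0"] by (simp add: Gamma00_1)

lemma fundamental_for_fund: "fundamental_for (Gamma0 l) (fund l)"
proof -
  have "\<exists>F. fundamental_set l F"
    using fundamental_for_exists[OF modular_group_Gamma0[of l]]
    by (simp add: fundamental_for_def fundamental_set_def)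
  hence "fundamental_set l (fund l)" unfolding fund_def by (rule someI_ex)
  thus ?thesis by (simp add: fundamental_for_def fundamental_set_def)
qed

text \<open>Division by d intertwines the two conjugate groups, so it carries orbits of
  \<open>Gamma00 l d\<close> bijectively to orbits of \<open>Gamma0 (l * d)\<close>.\<close>

lemma fundamental_for_conjugate:
  assumes d: "d > 0" and F: "fundamental_for (Gamma0 (l * d)) F"
  shows "fundamental_for (Gamma00 l d) (act (mat2 1 0 0 (int d)) -` F)"
  unfolding fundamental_for_def
proof (intro conjI ballI)
  define D where "D = mat2 1 0 0 (int d)"
  have detD: "det D > 0" using d by (simp add: D_def)
  have actD: "act D z = z / of_nat d" for z by (simp add: D_def)
  have inj: "act D z = act D w \<longleftrightarrow> z = w" for z w using d by (simp add: actD)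
  have F': "F \<in> sets borel" "F \<subseteq> uhp" using F by (auto simp: fundamental_for_def)
  show "act (mat2 1 0 0 (int d)) -` F \<in> sets borel"
    using measurable_sets[OF act_measurable F'(1), of "mat2 1 0 0 (int d)"] by simp
  show "act (mat2 1 0 0 (int d)) -` F \<subseteq> uhp"
    unfolding D_def[symmetric] using F'(2) act_not_uhp[OF detD] by fastforce
  have conj: "(\<exists>A\<in>Gamma00 l d. w = act A z) \<longleftrightarrow> (\<exists>A\<in>Gamma0 (l * d). act D w = act A (act D z))"
    if z: "Im z > 0" for z w
  proof
    assume "\<exists>A\<in>Gamma00 l d. w = act A z"
    then obtain A where A: "A \<in> Gamma00 l d" "w = act A z" by blast
    obtain a b c d' where abcd: "A = mat2 a b c d'" by (rule mat2_cases)
    obtain b' where b': "b = int d * b'" using A abcd by auto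
    define B where "B = mat2 a b' (int d * c) d'"
    have "B \<in> Gamma0 (l * d)" using A abcd b' by (auto simp: B_def mult_ac)
    moreover have "D ** A = B ** D" by (simp add: D_def abcd B_def b' mult_ac)
    hence "act D w = act B (act D z)"
      using z A abcd detD by (metis act_mult SL2Z_det modular_groupD(1)[OF modular_group_Gamma00] zero_less_one)
    ultimately show "\<exists>A\<in>Gamma0 (l * d). act D w = act A (act D z)" by blast
  next
    assume "\<exists>A\<in>Gamma0 (l * d). act D w = act A (act D z)"
    then obtain A where A: "A \<in> Gamma0 (l * d)" "act D w = act A (act D z)" by blast
    obtain a b c d' where abcd: "A = mat2 a b c d'" by (rule mat2_cases)
    obtain c' where c': "c = int (l * d) * c'" using A abcd by auto
    define B where "B = mat2 a (int d * b) (int l * c') d'"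
    have B: "B \<in> Gamma00 l d" using A abcd c' by (auto simp: B_def mult_ac)
    moreover have "D ** B = A ** D" by (simp add: D_def abcd B_def c' mult_ac)
    hence "act D w = act D (act B z)"
      using z A(2) B detD by (metis act_mult SL2Z_det modular_groupD(1)[OF modular_group_Gamma00] zero_less_one)
    ultimately show "\<exists>A\<in>Gamma00 l d. w = act A z" using inj by blast
  qed
  fix z assume z: "z \<in> uhp"
  have "act D z \<in> uhp" using z act_uhp[OF detD] by simp
  then obtain w where w: "w \<in> F" "\<exists>A\<in>Gamma0 (l * d). w = act A (act D z)"
    and uniq: "\<And>w'. w' \<in> F \<Longrightarrow> \<exists>A\<in>Gamma0 (l * d). w' = act A (act D z) \<Longrightarrow> w' = w"
    using F unfolding fundamental_for_def by (metis (no_types, lifting))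
  have Dw: "act D (of_nat d * w) = w" using d by (simp add: actD)
  show "\<exists>!w. w \<in> act (mat2 1 0 0 (int d)) -` F \<and> (\<exists>A\<in>Gamma00 l d. w = act A z)"
    unfolding D_def[symmetric]
  proof (rule ex1I[of _ "of_nat d * w"])
    show "of_nat d * w \<in> act D -` F \<and> (\<exists>A\<in>Gamma00 l d. of_nat d * w = act A z)"
      using w z conj[of z "of_nat d * w"] by (simp add: Dw)
    show "w' = of_nat d * w" if w': "w' \<in> act D -` F \<and> (\<exists>A\<in>Gamma00 l d. w' = act A z)" for w'
    proof -
      have "act D w' = w" using w' uniq[of "act D w'"] conj[of z w'] z by simp
      thus ?thesis using inj[of w' "of_nat d * w"] Dw by simp
    qed
  qed
qed

lemma ex1_linear_congruence:
  assumes "coprime u (int e)" "e > 0"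
  shows "\<exists>!j. j < e \<and> int e dvd x - u * int j"
proof -
  obtain v w where vw: "v * u + w * int e = 1" using assms(1) bezout_int[of u "int e"] by auto
  define j where "j = nat ((x * v) mod int e)"
  have j: "int j = (x * v) mod int e" using assms(2) by (simp add: j_def)
  have "int e dvd x * v - int j" unfolding j by (simp add: mod_eq_dvd_iff[symmetric])
  moreover have "u * (x * v - int j) + x * w * int e = x * (v * u + w * int e) - u * int j"
    by (simp add: algebra_simps)
  hence "x - u * int j = u * (x * v - int j) + x * w * int e"
    using vw by simp
  ultimately have jdvd: "int e dvd x - u * int j" by simp
  have jlt: "j < e" using pos_mod_bound[of "int e" "x * v"] assms(2) unfolding j[symmetric] by simp
  have juniq: "j' = j" if "j' < e \<and> int e dvd x - u * int j'" for j'
  proof -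
    have j': "j' < e" "int e dvd x - u * int j'" using that by auto
    have "int e dvd (x - u * int j) - (x - u * int j')" by (rule dvd_diff[OF jdvd j'(2)])
    hence "int e dvd u * (int j' - int j)" by (simp add: algebra_simps)
    hence "int e dvd int j' - int j" using assms(1) coprime_dvd_mult_right_iff[of "int e" u] coprime_commute by blast
    moreover have "\<bar>int j' - int j\<bar> < int e" using j' jlt by linarith
    ultimately show ?thesis
      using dvd_imp_le_int[of "int j' - int j" "int e"] by (cases "j' = j") auto
  qed
  show ?thesis by (rule ex1I[of _ j], rule conjI[OF jlt jdvd], erule juniq)
qed

text \<open>Makes matrix entries coprime to L invertible modulo d and e, which is how the cube
  condition reaches the count of cosets.\<close>

lemma coprime_of_radical_dvd:
  assumes "\<And>p. prime p \<Longrightarrow> p dvd e \<Longrightarrow> p dvd L" and "coprime x (int L)"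
  shows "coprime x (int e)"
proof (rule ccontr)
  assume "\<not> coprime x (int e)"
  hence "nat (gcd x (int e)) \<noteq> 1" by (simp add: coprime_iff_gcd_eq_1)
  then obtain p where p: "prime p" "p dvd nat (gcd x (int e))" using prime_factor_nat by blast
  hence "int p dvd gcd x (int e)" by (simp add: dvd_nat_abs_iff flip: int_dvd_int_iff)
  hence "int p dvd x" "int p dvd int e" by simp_all
  hence "int p dvd int L" using assms(1)[OF p(1)] by simp
  hence "int p dvd 1" using coprime_common_divisor[OF assms(2) \<open>int p dvd x\<close>] by blast
  thus False using p(1) by simp
qed

text \<open>An upper unipotent with entry a multiple of s times a lower one with entry a multiple of
  t L. Stretching by s and t coprime to d and e only permutes residues.\<close>

definition coset_rep :: "nat \<Rightarrow> nat \<Rightarrow> nat \<Rightarrow> nat \<times> nat \<Rightarrow> int^2^2" where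
  "coset_rep s t L p = mat2 1 (int (fst p * s)) 0 1 ** mat2 1 0 (int (snd p * t * L)) 1"

text \<open>Membership of \<open>A ** adj r\<close> in the subgroup amounts to two linear
  congruences: one modulo e for the lower index alone, then one modulo d for the upper index. The
  determinant makes their coefficients coprime to L, hence units by the radical conditions, so each
  congruence has exactly one solution.\<close>

lemma coset_reps_Gamma0:
  assumes "L > 0" "d > 0" "e > 0" "coprime s d" "coprime t e"
    and rad: "\<And>p. prime p \<Longrightarrow> p dvd d \<Longrightarrow> p dvd L" "\<And>p. prime p \<Longrightarrow> p dvd e \<Longrightarrow> p dvd L"
  shows "coset_reps (Gamma0 L) (Gamma00 (L * e) d) ({..<d} \<times> {..<e}) (coset_rep s t L)"
  unfolding coset_reps_def
proof (intro conjI ballI)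
  show "coset_rep s t L ` ({..<d} \<times> {..<e}) \<subseteq> Gamma0 L"
    by (auto simp: coset_rep_def)
  fix A assume A: "A \<in> Gamma0 L"
  obtain a b c d' where abcd: "A = mat2 a b c d'" by (rule mat2_cases)
  obtain c' where det: "a * d' - b * c = 1" and c': "c = int L * c'" using A abcd by auto
  \<comment> \<open>The upper left entry of A after the lower unipotent with index j has been
    removed.\<close>
  define a' where "a' j = a - b * int (j * t * L)" for j
  have cop: "coprime d' (int L)" "coprime (a' j) (int L)" for j
  proof -
    have "x dvd 1" if "x dvd d'" "x dvd int L" for x
      unfolding det[symmetric] c' using that by (intro dvd_diff) auto
    thus "coprime d' (int L)" by (auto intro: coprimeI)
    have "x dvd 1" if "x dvd a' j" "x dvd int L" for x
    proof -
      have "x dvd a' j + b * int (j * t * L)" using that by (intro dvd_add) auto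
      hence "x dvd a" by (simp add: a'_def)
      thus ?thesis unfolding det[symmetric] c' using that by (intro dvd_diff) auto
    qed
    thus "coprime (a' j) (int L)" by (auto intro: coprimeI)
  qed
  have "coprime (d' * int t) (int e)"
    using coprime_of_radical_dvd[OF rad(2) cop(1)] assms(5) by simp
  then obtain j where j: "j < e" "int e dvd c' - d' * int t * int j"
    and j_unique: "\<And>j'. j' < e \<Longrightarrow> int e dvd c' - d' * int t * int j' \<Longrightarrow> j' = j"
    using ex1_linear_congruence[OF _ assms(3)] by metis
  have "coprime (a' j * int s) (int d)"
    using coprime_of_radical_dvd[OF rad(1) cop(2)] assms(4) by simp
  then obtain i where i: "i < d" "int d dvd b - a' j * int s * int i"
    and i_unique: "\<And>i'. i' < d \<Longrightarrow> int d dvd b - a' j * int s * int i' \<Longrightarrow> i' = i"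
    using ex1_linear_congruence[OF _ assms(2)] by metis
  have rep: "(\<exists>B\<in>Gamma00 (L * e) d. A = B ** coset_rep s t L p) \<longleftrightarrow>
      int e dvd c' - d' * int t * int (snd p) \<and> int d dvd b - a' (snd p) * int s * int (fst p)" for p
  proof -
    define r where "r = coset_rep s t L p"
    have r: "r \<in> SL2Z" unfolding r_def coset_rep_def by (simp add: mat2_SL2Z)
    have "(\<exists>B\<in>Gamma00 (L * e) d. A = B ** r) \<longleftrightarrow> A ** adj r \<in> Gamma00 (L * e) d"
    proof
      assume "\<exists>B\<in>Gamma00 (L * e) d. A = B ** r"
      thus "A ** adj r \<in> Gamma00 (L * e) d"
        using adj_right[OF r] by (auto simp flip: matrix_mul_assoc)
    next
      assume "A ** adj r \<in> Gamma00 (L * e) d"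
      moreover have "A = (A ** adj r) ** r" using adj_left[OF r] by (simp flip: matrix_mul_assoc)
      ultimately show "\<exists>B\<in>Gamma00 (L * e) d. A = B ** r" by blast
    qed
    also have "A ** adj r \<in> SL2Z"
      using A r modular_groupD(1)[OF modular_group_Gamma0] by (intro mult_SL2Z) auto
    hence "A ** adj r \<in> Gamma00 (L * e) d \<longleftrightarrow>
        int (L * e) dvd (A ** adj r) $ 2 $ 1 \<and> int d dvd (A ** adj r) $ 1 $ 2"
      by (simp add: Gamma00_def)
    also have "(A ** adj r) $ 2 $ 1 = int L * (c' - d' * int t * int (snd p))"
      unfolding r_def coset_rep_def abcd c' by (simp add: algebra_simps)
    also have "(A ** adj r) $ 1 $ 2 = b - a' (snd p) * int s * int (fst p)"
      unfolding r_def coset_rep_def abcd a'_def by (simp add: algebra_simps)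
    finally show ?thesis using assms(1) by (simp add: r_def)
  qed
  show "\<exists>!p. p \<in> {..<d} \<times> {..<e} \<and> (\<exists>B\<in>Gamma00 (L * e) d. A = B ** coset_rep s t L p)"
    unfolding rep
  proof (rule ex1I[of _ "(i, j)"])
    show "(i, j) \<in> {..<d} \<times> {..<e} \<and> int e dvd c' - d' * int t * int (snd (i, j)) \<and>
        int d dvd b - a' (snd (i, j)) * int s * int (fst (i, j))"
      using i j by simp
    fix p assume p: "p \<in> {..<d} \<times> {..<e} \<and> int e dvd c' - d' * int t * int (snd p) \<and>
        int d dvd b - a' (snd p) * int s * int (fst p)"
    have "snd p = j" by (rule j_unique) (use p in auto)
    moreover have "fst p = i" by (rule i_unique) (use p \<open>snd p = j\<close> in auto)
    ultimately show "p = (i, j)" by (simp add: prod_eq_iff)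
  qed
qed auto

section \<open>Cusp forms and sums over cosets\<close>

lemma cusp_formsD:
  assumes "f \<in> cusp_forms k l"
  shows "\<And>z. \<not> Im z > 0 \<Longrightarrow> f z = 0" "f holomorphic_on uhp"
    "\<And>A z. A \<in> Gamma0 l \<Longrightarrow> Im z > 0 \<Longrightarrow> slash k f A z = f z" "cuspidal k f"
  using assms by (auto simp: cusp_forms_def cuspidal_def)

lemma cusp_formsI:
  assumes "\<And>z. \<not> Im z > 0 \<Longrightarrow> f z = 0" "f holomorphic_on uhp"
    "\<And>A z. A \<in> Gamma0 l \<Longrightarrow> Im z > 0 \<Longrightarrow> slash k f A z = f z" "cuspidal k f"
  shows "f \<in> cusp_forms k l"
  using assms by (auto simp: cusp_forms_def cuspidal_def)

text \<open>Right multiplication by A permutes the cosets \<open>G' ** r i\<close>, and the elements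
  of G' that appear are absorbed by the invariance of f.\<close>

lemma sum_cosets_cusp_form:
  assumes G': "modular_group G'" "G' \<subseteq> Gamma0 L" and r: "coset_reps (Gamma0 L) G' I r"
    and f: "\<And>z. \<not> Im z > 0 \<Longrightarrow> f z = 0" "f holomorphic_on uhp" "cuspidal k f"
      "\<And>A z. A \<in> G' \<Longrightarrow> Im z > 0 \<Longrightarrow> slash k f A z = f z"
  shows "(\<lambda>z. \<Sum>i\<in>I. slash k f (r i) z) \<in> cusp_forms k L"
proof (rule cusp_formsI)
  note GD = modular_groupD[OF modular_group_Gamma0[of L]] and GD' = modular_groupD[OF G'(1)]
  have fin: "finite I" and rI: "i \<in> I \<Longrightarrow> r i \<in> Gamma0 L"
    and ex: "A \<in> Gamma0 L \<Longrightarrow> \<exists>i\<in>I. \<exists>B\<in>G'. A = B ** r i"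
    and uniq: "\<And>B C. B ** r i \<in> Gamma0 L \<Longrightarrow> B ** r i = C ** r j \<Longrightarrow> i \<in> I \<Longrightarrow> j \<in> I \<Longrightarrow>
      B \<in> G' \<Longrightarrow> C \<in> G' \<Longrightarrow> i = j"
    for A i j
    using r unfolding coset_reps_def by blast+
  have rdet: "det (r i) > 0" if "i \<in> I" for i using rI[OF that] GD by simp
  show "(\<Sum>i\<in>I. slash k f (r i) z) = 0" if "\<not> Im z > 0" for z
    using that f(1) rdet by (intro sum.neutral) (auto simp: slash_not_uhp)
  show "(\<lambda>z. \<Sum>i\<in>I. slash k f (r i) z) holomorphic_on uhp"
    using f rdet by (intro holomorphic_on_sum slash_holomorphic)
  show "cuspidal k (\<lambda>z. \<Sum>i\<in>I. slash k f (r i) z)"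
    using f rdet by (intro cuspidal_sum cuspidal_slash)
  fix A z assume A: "A \<in> Gamma0 L" and z: "Im z > 0"
  have "\<exists>p. fst p \<in> I \<and> snd p \<in> G' \<and> r i ** A = snd p ** r (fst p)" if i: "i \<in> I" for i
  proof -
    obtain j B where "j \<in> I" "B \<in> G'" "r i ** A = B ** r j"
      using ex[OF GD(5)[OF rI[OF i] A]] by blast
    thus ?thesis by (intro exI[of _ "(j, B)"]) simp
  qed
  hence "\<forall>i\<in>I. \<exists>p. fst p \<in> I \<and> snd p \<in> G' \<and> r i ** A = snd p ** r (fst p)" by blast
  from bchoice[OF this] obtain p where
    p: "\<forall>i\<in>I. fst (p i) \<in> I \<and> snd (p i) \<in> G' \<and> r i ** A = snd (p i) ** r (fst (p i))" ..
  define \<pi> B where "\<pi> i = fst (p i)" and "B i = snd (p i)" for i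
  have \<pi>: "\<pi> i \<in> I" "B i \<in> G'" "r i ** A = B i ** r (\<pi> i)" if "i \<in> I" for i
    using p that by (auto simp: \<pi>_def B_def)
  have "inj_on \<pi> I"
  proof (rule inj_onI)
    fix i j assume ij: "i \<in> I" "j \<in> I" "\<pi> i = \<pi> j"
    have inv: "adj (B i) ** (r i ** A) = r (\<pi> i)" if "i \<in> I" for i
      using \<pi> that GD' by (simp add: matrix_mul_assoc adj_left)
    have "adj (B i) ** r i = (adj (B i) ** (r i ** A)) ** adj A" for i
      using A GD by (simp add: adj_right flip: matrix_mul_assoc)
    hence "adj (B i) ** r i = adj (B j) ** r j" using inv ij by simp
    moreover have "adj (B i) \<in> G'" "adj (B j) \<in> G'" using \<pi> ij GD' by auto
    moreover have "adj (B i) ** r i \<in> Gamma0 L" using \<open>adj (B i) \<in> G'\<close> G' rI ij GD by blast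
    ultimately show "i = j" using uniq ij by blast
  qed
  hence bij: "bij_betw \<pi> I I" using fin \<pi>(1) by (simp add: bij_betw_def endo_inj_surj image_subsetI)
  have "slash k (\<lambda>z. \<Sum>i\<in>I. slash k f (r i) z) A z = (\<Sum>i\<in>I. slash k f (r i ** A) z)"
    using A GD z by (simp add: slash_sum slash_mult)
  also have "\<dots> = (\<Sum>i\<in>I. slash k f (r (\<pi> i)) z)"
  proof (rule sum.cong)
    fix i assume i: "i \<in> I"
    have "slash k f (r i ** A) z = slash k (slash k f (B i)) (r (\<pi> i)) z"
      using \<pi> i rdet z by (simp add: slash_mult)
    also have "\<dots> = slash k f (r (\<pi> i)) z"
      using \<pi> i rdet z f(4) by (intro slash_cong) auto
    finally show "slash k f (r i ** A) z = slash k f (r (\<pi> i)) z" .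
  qed simp
  also have "\<dots> = (\<Sum>i\<in>I. slash k f (r i) z)" by (rule sum.reindex_bij_betw[OF bij])
  finally show "slash k (\<lambda>z. \<Sum>i\<in>I. slash k f (r i) z) A z = (\<Sum>i\<in>I. slash k f (r i) z)" .
qed

subsection \<open>Level raising and its adjoint\<close>

lemma cusp_forms_mono:
  assumes "l dvd l'" shows "cusp_forms k l \<subseteq> cusp_forms k l'"
proof -
  have "Gamma0 l' \<subseteq> Gamma0 l"
    using assms by (auto simp: Gamma0_def elim!: dvd_trans[rotated])
  thus ?thesis by (auto simp: cusp_forms_def)
qed

lemma cusp_forms_measurable:
  assumes "f \<in> cusp_forms k l" shows "f \<in> borel_measurable borel"
proof -
  have "(\<lambda>z. indicator uhp z *\<^sub>R f z) \<in> borel_measurable borel"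
    by (intro borel_measurable_continuous_on_indicator holomorphic_on_imp_continuous_on
        cusp_formsD(2)[OF assms]) simp
  also have "(\<lambda>z. indicator uhp z *\<^sub>R f z) = f"
    using cusp_formsD(1)[OF assms] by (auto simp: fun_eq_iff indicator_def)
  finally show ?thesis .
qed

lemma cusp_forms_scale:
  assumes "f \<in> cusp_forms k l" shows "(\<lambda>z. a * f z) \<in> cusp_forms k l"
  using cusp_formsD[OF assms]
  by (intro cusp_formsI) (auto simp: slash_scale intro!: holomorphic_intros cuspidal_scale)

lemma cusp_forms_sum:
  assumes "\<And>i. i \<in> I \<Longrightarrow> f i \<in> cusp_forms k l"
  shows "(\<lambda>z. \<Sum>i\<in>I. f i z) \<in> cusp_forms k l"
proof (rule cusp_formsI)
  show "(\<lambda>z. \<Sum>i\<in>I. f i z) holomorphic_on uhp" "cuspidal k (\<lambda>z. \<Sum>i\<in>I. f i z)"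
    using cusp_formsD[OF assms] by (auto intro!: holomorphic_on_sum cuspidal_sum)
qed (use cusp_formsD[OF assms] in \<open>auto simp: slash_sum\<close>)

lemma cusp_forms_zero: "(\<lambda>z. 0) \<in> cusp_forms k l"
  using cusp_forms_sum[of "{}"] by simp

lemma cusp_forms_add:
  assumes "f \<in> cusp_forms k l" "g \<in> cusp_forms k l"
  shows "(\<lambda>z. f z + g z) \<in> cusp_forms k l"
  using cusp_forms_sum[of "{True, False}" "\<lambda>b. if b then f else g" k l] assms by simp

text \<open>\<open>slash\<close> carries no determinant factor, so the power of d stays
  explicit.\<close>

lemma level_raise_slash:
  "level_raise k d f = (\<lambda>z. of_real (real d powr (real k / 2)) * slash k f (mat2 (int d) 0 0 1) z)"
  by (simp add: level_raise_def slash_def fun_eq_iff)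

text \<open>Conjugation by diag(d, 1) maps \<open>Gamma0 (l * d)\<close> into
  \<open>Gamma0 l\<close>.\<close>

lemma level_raise_cusp_form:
  assumes d: "d > 0" and f: "f \<in> cusp_forms k l"
  shows "level_raise k d f \<in> cusp_forms k (l * d)"
  unfolding level_raise_slash
proof (intro cusp_forms_scale cusp_formsI)
  define D where "D = mat2 (int d) 0 0 1"
  have D: "det D > 0" using d by (simp add: D_def)
  note fD = cusp_formsD[OF f]
  show "slash k f D z = 0" if "\<not> Im z > 0" for z using that fD D by (simp add: slash_not_uhp)
  show "slash k f D holomorphic_on uhp" by (rule slash_holomorphic[OF fD(2) D])
  show "cuspidal k (slash k f D)" by (rule cuspidal_slash[OF fD(4) D])
  fix A z assume A: "A \<in> Gamma0 (l * d)" and z: "Im z > 0"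
  obtain a b c d' where abcd: "A = mat2 a b c d'" by (rule mat2_cases)
  obtain c' where c': "c = int (l * d) * c'" using A abcd by auto
  define A' where "A' = mat2 a (int d * b) (int l * c') d'"
  have A': "A' \<in> Gamma0 l" using A abcd c' by (simp add: A'_def mult_ac)
  have "D ** A = A' ** D" by (simp add: D_def abcd A'_def c' mult_ac)
  moreover have "det A > 0" using modular_groupD(1)[OF modular_group_Gamma0 A] by simp
  ultimately have "slash k (slash k f D) A z = slash k (slash k f A') D z"
    using z D by (simp add: slash_mult)
  also have "\<dots> = slash k f D z" using fD(3)[OF A'] D z by (intro slash_cong)
  finally show "slash k (slash k f D) A z = slash k f D z" .
qed

lemma level_raise_1 [simp]: "level_raise k (Suc 0) f = f"
  by (simp add: level_raise_def fun_eq_iff)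

lemma level_raise_mult: "level_raise k (a * b) f = level_raise k a (level_raise k b f)"
  by (simp add: level_raise_def fun_eq_iff powr_mult mult_ac)

lemma level_raise_sum:
  "level_raise k d (\<lambda>z. \<Sum>i\<in>I. a i * f i z) w = (\<Sum>i\<in>I. a i * level_raise k d (f i) w)"
  by (simp add: level_raise_def sum_distrib_left mult_ac)

lemma slash_diagonal_invariant:
  assumes d: "d > 0" and g: "g \<in> cusp_forms k (l * d)" and A: "A \<in> Gamma00 l d" and z: "Im z > 0"
  shows "slash k (slash k g (mat2 1 0 0 (int d))) A z = slash k g (mat2 1 0 0 (int d)) z"
proof -
  define D where "D = mat2 1 0 0 (int d)"
  have D: "det D > 0" using d by (simp add: D_def)
  obtain a b c d' where abcd: "A = mat2 a b c d'" by (rule mat2_cases)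
  obtain b' where b': "b = int d * b'" using A abcd by auto
  define A' where "A' = mat2 a b' (int d * c) d'"
  have A': "A' \<in> Gamma0 (l * d)" using A abcd b' by (auto simp: A'_def mult_ac)
  have "D ** A = A' ** D" by (simp add: D_def abcd A'_def b' mult_ac)
  moreover have "det A > 0" using modular_groupD(1)[OF modular_group_Gamma00 A] by simp
  ultimately have "slash k (slash k g D) A z = slash k (slash k g A') D z"
    using z D by (simp add: slash_mult)
  also have "\<dots> = slash k g D z" using cusp_formsD(3)[OF g A'] D z by (intro slash_cong)
  finally show ?thesis by (simp add: D_def)
qed

text \<open>For s = t = 1 this is the adjoint of \<open>level_raise k d\<close> from level L to
  level L d e. Slashing by diag(1, d) and multiplying by d^(k/2) undoes the raising; the division by
  d e is the ratio of volumes, that is, the index. Other s and t only change the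
  representatives.\<close>

definition trace_sum :: "nat \<Rightarrow> nat \<Rightarrow> nat \<Rightarrow> nat \<Rightarrow> nat \<Rightarrow> nat \<Rightarrow> (complex \<Rightarrow> complex) \<Rightarrow> complex \<Rightarrow> complex" where
  "trace_sum k d e s t L g z = of_real (real d powr (real k / 2) / real (d * e)) *
     (\<Sum>p\<in>{..<d} \<times> {..<e}. slash k (slash k g (mat2 1 0 0 (int d))) (coset_rep s t L p) z)"

abbreviation trace_form :: "nat \<Rightarrow> nat \<Rightarrow> nat \<Rightarrow> nat \<Rightarrow> (complex \<Rightarrow> complex) \<Rightarrow> complex \<Rightarrow> complex" where
  "trace_form k d e L \<equiv> trace_sum k d e (Suc 0) (Suc 0) L"

text \<open>The prime condition makes \<open>Gamma00 (L * e) d\<close> have index exactly d e in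
  \<open>Gamma0 L\<close>.\<close>

definition admissible :: "nat \<Rightarrow> nat \<Rightarrow> nat \<Rightarrow> bool" where
  "admissible L d e \<longleftrightarrow> L > 0 \<and> d > 0 \<and> e > 0 \<and> (\<forall>p. prime p \<longrightarrow> p dvd d * e \<longrightarrow> p dvd L)"

lemma admissible_coset_reps:
  assumes "admissible L d e" "coprime s d" "coprime t e"
  shows "coset_reps (Gamma0 L) (Gamma00 (L * e) d) ({..<d} \<times> {..<e}) (coset_rep s t L)"
  using assms unfolding admissible_def by (intro coset_reps_Gamma0) auto

lemma Gamma00_subset: "Gamma00 (L * e) d \<subseteq> Gamma0 L"
  by (auto simp: Gamma00_def Gamma0_def elim: dvd_trans[rotated])

lemma det_coset_rep [simp]: "det (coset_rep s t L p) = 1"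
  by (simp add: coset_rep_def)

lemma trace_sum_cusp_form:
  assumes adm: "admissible L d e" and st: "coprime s d" "coprime t e"
    and g: "g \<in> cusp_forms k (L * d * e)"
  shows "trace_sum k d e s t L g \<in> cusp_forms k L"
  unfolding trace_sum_def[abs_def]
proof (intro cusp_forms_scale sum_cosets_cusp_form[OF modular_group_Gamma00 Gamma00_subset
      admissible_coset_reps[OF adm st]])
  have d: "d > 0" using adm by (simp add: admissible_def)
  hence D: "det (mat2 1 0 0 (int d)) > 0" by simp
  note gD = cusp_formsD[OF g]
  show "slash k g (mat2 1 0 0 (int d)) z = 0" if "\<not> Im z > 0" for z
    using that gD D by (intro slash_not_uhp)
  show "slash k g (mat2 1 0 0 (int d)) holomorphic_on uhp" by (rule slash_holomorphic[OF gD(2) D])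
  show "cuspidal k (slash k g (mat2 1 0 0 (int d)))" by (rule cuspidal_slash[OF gD(4) D])
  have g': "g \<in> cusp_forms k (L * e * d)" using g by (simp add: mult_ac)
  show "slash k (slash k g (mat2 1 0 0 (int d))) A z = slash k g (mat2 1 0 0 (int d)) z"
    if "A \<in> Gamma00 (L * e) d" "Im z > 0" for A z
    using slash_diagonal_invariant[OF d g' that] .
qed

text \<open>The representatives \<open>coset_rep 1 1 (L * p)\<close> for level \<open>L * p\<close> are also representatives for
  level \<open>L\<close>, with the lower entries stretched by \<open>p\<close>. So the trace of a form that already lives on
  level \<open>L * d * e\<close> drops to level \<open>L\<close>.\<close>

lemma trace_form_of_lower_level:
  assumes "admissible L d e" "coprime p e" "g \<in> cusp_forms k (L * d * e)"
  shows "trace_form k d e (L * p) g \<in> cusp_forms k L"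
proof -
  have "trace_form k d e (L * p) g = trace_sum k d e (Suc 0) p L g"
    by (simp add: trace_sum_def fun_eq_iff coset_rep_def mult_ac)
  thus ?thesis using trace_sum_cusp_form[OF assms(1) _ assms(2,3), of "Suc 0"] by simp
qed

text \<open>Moving diag(p, 1) past a representative multiplies its upper entry by p and divides its
  lower entry by p. Representatives built for L p thus become representatives for L with s = p, and
  the raising by p ends up outside the trace.\<close>

lemma trace_form_of_raised:
  assumes "admissible L d e" "coprime p d" "p > 0" "g \<in> cusp_forms k (L * d * e)"
  shows "\<exists>f\<in>cusp_forms k L. trace_form k d e (L * p) (level_raise k p g) = level_raise k p f"
proof
  show "trace_sum k d e p (Suc 0) L g \<in> cusp_forms k L"
    using assms by (intro trace_sum_cusp_form) auto
  have d: "d > 0" using assms(1) by (simp add: admissible_def)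
  define P D where "P = mat2 (int p) 0 0 1" and "D = mat2 1 0 0 (int d)"
  have PD: "det P > 0" "det D > 0" using d assms(3) by (simp_all add: P_def D_def)
  have mat: "P ** (D ** coset_rep (Suc 0) (Suc 0) (L * p) i) = (D ** coset_rep p (Suc 0) L i) ** P" for i
    by (simp add: P_def D_def coset_rep_def algebra_simps)
  have comm: "slash k (slash k (slash k g P) D) (coset_rep (Suc 0) (Suc 0) (L * p) i) z =
      slash k (slash k (slash k g D) (coset_rep p (Suc 0) L i)) P z" for i z
  proof (cases "Im z > 0")
    case True
    have u: "Im (act A z) > 0" if "det A > 0" for A using True that by (rule act_uhp[rotated])
    show ?thesis
      using True PD u mat[of i] by (simp add: slash_mult det_mul slash_cong[OF slash_mult] matrix_mul_assoc)
  next
    case False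
    have "g w = 0" if "\<not> Im w > 0" for w using cusp_formsD(1)[OF assms(4)] that .
    hence zero: "slash k g A w = 0" if "\<not> Im w > 0" "det A > 0" for A w
      using that by (simp add: slash_not_uhp)
    have "slash k (slash k g A) A' w = 0" if "\<not> Im w > 0" "det A > 0" "det A' > 0" for A A' w
      by (rule slash_not_uhp[OF zero]) (use that in auto)
    thus ?thesis using False PD by (simp add: slash_not_uhp)
  qed
  show "trace_form k d e (L * p) (level_raise k p g) = level_raise k p (trace_sum k d e p (Suc 0) L g)"
    unfolding level_raise_slash trace_sum_def[abs_def] P_def[symmetric] D_def[symmetric]
    by (rule ext) (simp only: slash_scale[abs_def] slash_sum[abs_def] comm, simp add: mult_ac flip: sum_distrib_left)
qed

text \<open>All d e summands are the same multiple of f, because the representatives lie in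
  \<open>Gamma0 L\<close>; the normalization makes the total f.\<close>

lemma trace_form_level_raise:
  assumes adm: "admissible L d e" and f: "f \<in> cusp_forms k L"
  shows "trace_form k d e L (level_raise k d f) = f"
proof
  fix z
  have de: "d > 0" "e > 0" using adm by (simp_all add: admissible_def)
  have sl: "slash k (slash k (level_raise k d f) (mat2 1 0 0 (int d))) (coset_rep (Suc 0) (Suc 0) L p) z =
      of_real (real d powr (real k / 2)) * f z / of_nat d ^ k" for p
  proof -
    have "slash k (level_raise k d f) (mat2 1 0 0 (int d)) =
        (\<lambda>w. (of_real (real d powr (real k / 2)) / of_nat d ^ k) * f w)"
      using de by (simp add: slash_def level_raise_def fun_eq_iff)
    moreover have "slash k f (coset_rep (Suc 0) (Suc 0) L p) z = f z"
    proof (cases "Im z > 0")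
      case True
      moreover have "coset_rep (Suc 0) (Suc 0) L p \<in> Gamma0 L" by (simp add: coset_rep_def)
      ultimately show ?thesis using cusp_formsD(3)[OF f] by simp
    next
      case False
      thus ?thesis using cusp_formsD(1)[OF f] by (simp add: slash_not_uhp)
    qed
    ultimately show ?thesis by (simp only: slash_scale) simp
  qed
  have "real d powr (real k / 2) * real d powr (real k / 2) = real d ^ k"
    using de by (simp add: powr_realpow flip: powr_add)
  hence "complex_of_real (real d powr (real k / 2)) * of_real (real d powr (real k / 2)) = of_nat d ^ k"
    by (metis of_real_mult of_real_of_nat_eq of_real_power)
  thus "trace_form k d e L (level_raise k d f) z = f z"
    using de by (simp add: trace_sum_def sl card_cartesian_product field_simps)
qed

section \<open>Adjointness of trace and level raising\<close>

lemma slash_pairing: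
  assumes A: "A \<in> SL2Z" and z: "Im z > 0"
  shows "f (act A z) * cnj (g (act A z)) * of_real (Im (act A z) ^ k) =
    slash k f A z * cnj (slash k g A z) * of_real (Im z ^ k)"
proof -
  have "autf A z \<noteq> 0" using autf_nonzero[of A z] A z by simp
  moreover have "complex_of_real ((cmod (autf A z))\<^sup>2) = autf A z * cnj (autf A z)"
    by (simp add: complex_mult_cnj cmod_power2)
  hence "complex_of_real (Im (act A z) ^ k) = of_real (Im z ^ k) / (autf A z ^ k * cnj (autf A z) ^ k)"
    using A by (simp add: Im_act power_divide flip: power_mult_distrib)
  ultimately show ?thesis by (simp add: slash_def field_simps)
qed

text \<open>Unfolding of the constant 1. The identity holds for extended values; in the infinite
  case \<open>measure\<close> makes both sides 0.\<close>

lemma vol_index: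
  assumes adm: "admissible L d e"
  shows "vol (L * d * e) = real (d * e) * vol L"
proof -
  have d: "d > 0" using adm by (simp add: admissible_def)
  define F where "F = fund (L * e * d)"
  have F: "fundamental_for (Gamma0 (L * e * d)) F" by (simp add: F_def fundamental_for_fund)
  define D where "D = mat2 1 0 0 (int d)"
  have D: "det D > 0" using d by (simp add: D_def)
  have [measurable]: "F \<in> sets borel" "fund L \<in> sets borel"
    using F fundamental_for_fund[of L] by (auto simp: fundamental_for_def)
  have "emeasure hyp_measure F = (\<integral>\<^sup>+z. indicator F z \<partial>hyp_measure)" by simp
  also have "\<dots> = (\<integral>\<^sup>+z. indicator F (act D z) \<partial>hyp_measure)"
    by (rule nn_integral_act[OF D, symmetric]) measurable
  also have "\<dots> = (\<integral>\<^sup>+z. 1 * indicator (act D -` F) z \<partial>hyp_measure)"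
    by (intro nn_integral_cong) (simp add: indicator_def)
  also have "\<dots> = (\<Sum>i\<in>{..<d} \<times> {..<e}. \<integral>\<^sup>+z. 1 * indicator (fund L) z \<partial>hyp_measure)"
    unfolding D_def by (rule nn_integral_unfold[OF modular_group_Gamma0 modular_group_Gamma00 Gamma00_subset
          admissible_coset_reps[OF adm, of "Suc 0" "Suc 0"] fundamental_for_fund fundamental_for_conjugate[OF d F]]) auto
  also have "\<dots> = of_nat (d * e) * emeasure hyp_measure (fund L)"
    by (simp add: card_cartesian_product)
  finally have "emeasure hyp_measure F = ennreal (real (d * e)) * emeasure hyp_measure (fund L)"
    by (simp add: ennreal_of_nat_eq_real_of_nat)
  thus ?thesis by (simp add: vol_def measure_def enn2real_mult F_def mult_ac)
qed

text \<open>Replacing z by z/d turns the raised form into h itself and g into a form for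
  \<open>Gamma00 (L * e) d\<close>. Unfolding to \<open>Gamma0 L\<close> then sums only the g factor
  over cosets, as h is invariant under the representatives.\<close>

lemma petersson_trace_form:
  assumes adm: "admissible L d e"
    and g: "g \<in> cusp_forms k (L * d * e)" and h: "h \<in> cusp_forms k L"
    and int: "set_integrable hyp_measure (fund (L * d * e))
      (\<lambda>z. g z * cnj (level_raise k d h z) * of_real (Im z ^ k))"
  shows "petersson c k (L * d * e) g (level_raise k d h) = petersson c k L (trace_form k d e L g) h"
proof -
  have d: "d > 0" "e > 0" using adm by (simp_all add: admissible_def)
  define F where "F = fund (L * e * d)"
  have F: "fundamental_for (Gamma0 (L * e * d)) F" by (simp add: F_def fundamental_for_fund)
  have Fq: "fund (L * d * e) = F" by (simp add: F_def mult_ac)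
  define D where "D = mat2 1 0 0 (int d)"
  have D: "det D > 0" using d by (simp add: D_def)
  have actD: "act D z = z / of_nat d" for z by (simp add: D_def)
  have F' [measurable]: "F \<in> sets borel" "fund L \<in> sets borel"
    using F fundamental_for_fund[of L] by (auto simp: fundamental_for_def)
  have meas [measurable]: "g \<in> borel_measurable borel" "h \<in> borel_measurable borel"
    "level_raise k d h \<in> borel_measurable borel"
    using g h level_raise_cusp_form[OF d(1) h] by (auto intro: cusp_forms_measurable)
  define G where "G = slash k g D"
  have [measurable]: "G \<in> borel_measurable borel" unfolding G_def slash_def by measurable
  have [measurable]: "cnj \<in> borel_measurable borel" "complex_of_real \<in> borel_measurable borel"
    by (intro borel_measurable_continuous_onI continuous_intros)+
  define \<phi> where "\<phi> z = G z * cnj (h z) * of_real (Im z ^ k)" for z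
  have \<phi>_meas: "\<phi> \<in> borel_measurable borel" unfolding \<phi>_def by measurable
  define \<psi> where "\<psi> z = g z * cnj (level_raise k d h z) * of_real (Im z ^ k)" for z
  have \<psi>_meas: "\<psi> \<in> borel_measurable borel" unfolding \<psi>_def by measurable
  define a where "a = complex_of_real (real d powr (real k / 2))"
  have a: "a \<noteq> 0" using d by (simp add: a_def)
  \<comment> \<open>Raising contributes d^(k/2) and the imaginary part contributes d^(-k), which
    \<open>slash\<close> by diag(1, d) already contains.\<close>
  have \<psi>\<phi>: "\<psi> (act D z) = a * \<phi> z" for z
    using d unfolding \<psi>_def \<phi>_def G_def slash_def level_raise_def a_def
    by (simp add: D_def power_divide)
  define F'' where "F'' = act D -` F"
  have int': "set_integrable hyp_measure F'' \<phi>"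
  proof -
    have "set_integrable hyp_measure F \<psi>"
      using int by (simp add: Fq \<psi>_def[abs_def])
    hence "set_integrable hyp_measure F'' (\<lambda>z. a * \<phi> z)"
      using set_integral_act(2)[OF D \<psi>_meas F'(1)] by (simp add: F''_def \<psi>\<phi>)
    thus ?thesis using a by (simp add: set_integrable_mult_right_iff)
  qed
  have inv: "\<phi> (act A z) = \<phi> z" if A: "A \<in> Gamma00 (L * e) d" and z: "Im z > 0" for A z
  proof -
    have "g \<in> cusp_forms k (L * e * d)" using g by (simp add: mult_ac)
    moreover have "A \<in> SL2Z" "A \<in> Gamma0 L"
      using A Gamma00_subset by (auto simp: Gamma00_def)
    ultimately show ?thesis
      using slash_pairing[of A z G h k] slash_diagonal_invariant[OF d(1) _ A z] z cusp_formsD(3)[OF h]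
      by (simp add: \<phi>_def G_def D_def)
  qed
  have reps: "coset_reps (Gamma0 L) (Gamma00 (L * e) d) ({..<d} \<times> {..<e}) (coset_rep (Suc 0) (Suc 0) L)"
    using admissible_coset_reps[OF adm] by simp
  note unf = set_integral_unfold[OF modular_group_Gamma0 modular_group_Gamma00 Gamma00_subset reps
      fundamental_for_fund fundamental_for_conjugate[OF d(1) F] \<phi>_meas inv int'[unfolded F''_def D_def]]
  have \<phi>r: "\<phi> (act (coset_rep (Suc 0) (Suc 0) L p) z) =
      slash k G (coset_rep (Suc 0) (Suc 0) L p) z * cnj (h z) * of_real (Im z ^ k)" if z: "z \<in> fund L" for z p
  proof -
    have "coset_rep (Suc 0) (Suc 0) L p \<in> Gamma0 L" by (simp add: coset_rep_def)
    moreover have "Im z > 0"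
      using z fundamental_for_fund[of L] by (auto simp: fundamental_for_def)
    ultimately show ?thesis
      using slash_pairing[of "coset_rep (Suc 0) (Suc 0) L p" z G h k] cusp_formsD(3)[OF h]
        modular_groupD(1)[OF modular_group_Gamma0] by (simp add: \<phi>_def)
  qed
  have "(LINT z:F|hyp_measure. \<psi> z) = (LINT z:F''|hyp_measure. \<psi> (act D z))"
    unfolding F''_def by (rule set_integral_act(1)[OF D \<psi>_meas F'(1), symmetric])
  also have "\<dots> = a * (LINT z:F''|hyp_measure. \<phi> z)" by (simp add: \<psi>\<phi>)
  also have "(LINT z:F''|hyp_measure. \<phi> z) = (\<Sum>p\<in>{..<d} \<times> {..<e}. LINT z:fund L|hyp_measure.
      \<phi> (act (coset_rep (Suc 0) (Suc 0) L p) z))"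
    unfolding F''_def D_def using unf(2) by simp
  also have "\<dots> = (LINT z:fund L|hyp_measure. \<Sum>p\<in>{..<d} \<times> {..<e}. \<phi> (act (coset_rep (Suc 0) (Suc 0) L p) z))"
    unfolding set_lebesgue_integral_def scaleR_sum_right
    by (rule Bochner_Integration.integral_sum[symmetric]) (use unf(1) in \<open>simp add: set_integrable_def\<close>)
  also have "a * \<dots> = of_nat (d * e) * (LINT z:fund L|hyp_measure.
      trace_form k d e L g z * cnj (h z) * of_real (Im z ^ k))"
    unfolding set_integral_mult_right[symmetric]
    by (intro set_lebesgue_integral_cong ballI allI impI)
      (use d in \<open>simp_all add: \<phi>r trace_sum_def a_def G_def D_def sum_distrib_left sum_distrib_right mult_ac\<close>)
  finally have "petersson c k (L * d * e) g (level_raise k d h) =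
      of_real (c / vol (L * d * e)) * of_nat (d * e) * (LINT z:fund L|hyp_measure.
        trace_form k d e L g z * cnj (h z) * of_real (Im z ^ k))"
    unfolding petersson_def Fq \<psi>_def by simp
  \<comment> \<open>The index cancels against the ratio of volumes; if \<open>vol L\<close> is 0,
    both sides are 0.\<close>
  moreover have "complex_of_real (c / vol (L * d * e)) * of_nat (d * e) = of_real (c / vol L)"
    using d unfolding vol_index[OF adm] by (simp add: divide_simps)
  ultimately show ?thesis unfolding petersson_def[of c k L] by (simp only:)
qed

subsection \<open>The Petersson product on cusp forms\<close>

lemma sum_apply: "(\<Sum>i\<in>I. f i) z = (\<Sum>i\<in>I. f i z)" for f :: "'i \<Rightarrow> complex \<Rightarrow> complex"
  by (induction I rule: infinite_finite_induct) auto

lemma orthonormal_basis_combination: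
  assumes "orthonormal_basis c k l V B" "f \<in> V"
  obtains u where "f = (\<lambda>z. \<Sum>b\<in>B. u b * b z)"
proof -
  have "f \<in> range (\<lambda>u. \<Sum>b\<in>B. (\<lambda>z. u b * b z))"
    using assms cfun.span_finite[of B] by (simp add: orthonormal_basis_def)
  then obtain u where "f = (\<Sum>b\<in>B. (\<lambda>z. u b * b z))" by blast
  hence "f = (\<lambda>z. \<Sum>b\<in>B. u b * b z)" by (simp add: fun_eq_iff sum_apply)
  thus ?thesis by (rule that)
qed

abbreviation petersson_integrable :: "nat \<Rightarrow> nat \<Rightarrow> (complex \<Rightarrow> complex) \<Rightarrow> (complex \<Rightarrow> complex) \<Rightarrow> bool" where
  "petersson_integrable k l f g \<equiv>
     set_integrable hyp_measure (fund l) (\<lambda>z. f z * cnj (g z) * of_real (Im z ^ k))"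

lemma norm_mult_cnj_le: "cmod (x * cnj y * r) \<le> cmod (x * cnj x * r) + cmod (y * cnj y * r)"
proof -
  have "cmod x * cmod y \<le> cmod x * cmod x + cmod y * cmod y"
    using sum_squares_bound[of "cmod x" "cmod y"] mult_nonneg_nonneg[OF norm_ge_zero norm_ge_zero, of x y]
    unfolding power2_eq_square by linarith
  from mult_right_mono[OF this, of "cmod r"] show ?thesis
    by (simp add: norm_mult distrib_right)
qed

text \<open>An orthonormal basis function has a nonzero integral, and the Bochner integral of a
  non-integrable function is zero.\<close>

lemma petersson_integrable_cusp_forms:
  assumes onb: "orthonormal_basis c k l (cusp_forms k l) B"
    and f: "f \<in> cusp_forms k l" and g: "g \<in> cusp_forms k l"
  shows "petersson_integrable k l f g"
proof -
  have [measurable]: "fund l \<in> sets borel"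
    using fundamental_for_fund[of l] by (auto simp: fundamental_for_def)
  have [measurable]: "cnj \<in> borel_measurable borel" "complex_of_real \<in> borel_measurable borel"
    by (intro borel_measurable_continuous_onI continuous_intros)+
  have self: "petersson_integrable k l b b" if "b \<in> B" for b
  proof (rule ccontr)
    assume "\<not> ?thesis"
    hence "(LINT z:fund l|hyp_measure. b z * cnj (b z) * of_real (Im z ^ k)) = 0"
      unfolding set_integrable_def set_lebesgue_integral_def by (rule not_integrable_integral_eq)
    hence "petersson c k l b b = 0" unfolding petersson_def by (simp only: mult_zero_right)
    thus False using onb that by (auto simp: orthonormal_basis_def)
  qed
  have pair: "petersson_integrable k l b b'" if b: "b \<in> B" "b' \<in> B" for b b'
    unfolding set_integrable_def
  proof (rule Bochner_Integration.integrable_bound)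
    have "b \<in> cusp_forms k l" "b' \<in> cusp_forms k l" using b onb by (auto simp: orthonormal_basis_def)
    hence [measurable]: "b \<in> borel_measurable borel" "b' \<in> borel_measurable borel"
      by (auto intro: cusp_forms_measurable)
    show "(\<lambda>z. indicator (fund l) z *\<^sub>R (b z * cnj (b' z) * of_real (Im z ^ k))) \<in> borel_measurable hyp_measure"
      by measurable
    show "integrable hyp_measure (\<lambda>z. cmod (indicator (fund l) z *\<^sub>R (b z * cnj (b z) * of_real (Im z ^ k))) +
        cmod (indicator (fund l) z *\<^sub>R (b' z * cnj (b' z) * of_real (Im z ^ k))))"
      using self[OF b(1)] self[OF b(2)] unfolding set_integrable_def
      by (intro Bochner_Integration.integrable_add integrable_norm)
    show "AE z in hyp_measure. norm (indicator (fund l) z *\<^sub>R (b z * cnj (b' z) * of_real (Im z ^ k))) \<le>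
        norm (cmod (indicator (fund l) z *\<^sub>R (b z * cnj (b z) * of_real (Im z ^ k))) +
          cmod (indicator (fund l) z *\<^sub>R (b' z * cnj (b' z) * of_real (Im z ^ k))))"
      using norm_mult_cnj_le by (intro always_eventually allI) (auto simp: indicator_def)
  qed
  obtain u where u: "f = (\<lambda>z. \<Sum>b\<in>B. u b * b z)" using orthonormal_basis_combination[OF onb f] .
  obtain v where v: "g = (\<lambda>z. \<Sum>b\<in>B. v b * b z)" using orthonormal_basis_combination[OF onb g] .
  have "set_integrable hyp_measure (fund l)
      (\<lambda>z. \<Sum>b'\<in>B. \<Sum>b\<in>B. u b * cnj (v b') * (b z * cnj (b' z) * of_real (Im z ^ k)))"
    using pair unfolding set_integrable_def scaleR_sum_right
    by (intro Bochner_Integration.integrable_sum) (simp add: set_integrable_def flip: mult_scaleR_right)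
  also have "(\<lambda>z. \<Sum>b'\<in>B. \<Sum>b\<in>B. u b * cnj (v b') * (b z * cnj (b' z) * of_real (Im z ^ k))) =
      (\<lambda>z. f z * cnj (g z) * of_real (Im z ^ k))"
    by (simp add: u v fun_eq_iff sum_distrib_left sum_distrib_right mult_ac)
  finally show ?thesis .
qed

lemma petersson_cnj: "petersson c k l g f = cnj (petersson c k l f g)"
proof -
  have "(LINT z:fund l|hyp_measure. g z * cnj (f z) * of_real (Im z ^ k)) =
      (LINT z:fund l|hyp_measure. cnj (f z * cnj (g z) * of_real (Im z ^ k)))"
    by (simp add: mult_ac)
  also have "\<dots> = cnj (LINT z:fund l|hyp_measure. f z * cnj (g z) * of_real (Im z ^ k))"
    unfolding set_lebesgue_integral_def by (simp only: complex_cnj_scaleR[symmetric] Bochner_Integration.integral_cnj)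
  finally show ?thesis by (simp add: petersson_def)
qed

lemma petersson_sum_left:
  assumes onb: "orthonormal_basis c k l (cusp_forms k l) B"
    and f: "\<And>i. i \<in> I \<Longrightarrow> f i \<in> cusp_forms k l" and g: "g \<in> cusp_forms k l"
  shows "petersson c k l (\<lambda>z. \<Sum>i\<in>I. a i * f i z) g = (\<Sum>i\<in>I. a i * petersson c k l (f i) g)"
proof -
  have int: "petersson_integrable k l (f i) g" if "i \<in> I" for i
    by (rule petersson_integrable_cusp_forms[OF onb f[OF that] g])
  have "(LINT z:fund l|hyp_measure. (\<Sum>i\<in>I. a i * f i z) * cnj (g z) * of_real (Im z ^ k)) =
      (LINT z:fund l|hyp_measure. \<Sum>i\<in>I. a i * (f i z * cnj (g z) * of_real (Im z ^ k)))"
    by (simp add: sum_distrib_left sum_distrib_right mult_ac)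
  also have "\<dots> = (\<Sum>i\<in>I. LINT z:fund l|hyp_measure. a i * (f i z * cnj (g z) * of_real (Im z ^ k)))"
    using int unfolding set_lebesgue_integral_def scaleR_sum_right
    by (intro Bochner_Integration.integral_sum) (simp add: set_integrable_def flip: mult_scaleR_right)
  also have "\<dots> = (\<Sum>i\<in>I. a i * (LINT z:fund l|hyp_measure. f i z * cnj (g z) * of_real (Im z ^ k)))"
    by (simp only: set_integral_mult_right)
  finally show ?thesis unfolding petersson_def by (simp only: sum_distrib_left mult_ac)
qed

lemma petersson_sum_right:
  assumes onb: "orthonormal_basis c k l (cusp_forms k l) B"
    and f: "\<And>i. i \<in> I \<Longrightarrow> f i \<in> cusp_forms k l" and g: "g \<in> cusp_forms k l"
  shows "petersson c k l g (\<lambda>z. \<Sum>i\<in>I. a i * f i z) = (\<Sum>i\<in>I. cnj (a i) * petersson c k l g (f i))"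
  by (subst petersson_cnj, subst petersson_sum_left[OF onb f g])
    (simp_all add: petersson_cnj[of c k l _ g])

text \<open>\<open>C\<close> is the basis expanded in; \<open>B\<close>, a basis of the full space,
  supplies the integrability behind linearity of the pairing.\<close>

lemma orthonormal_basis_expansion:
  assumes onb: "orthonormal_basis c k l (cusp_forms k l) B"
    and V: "orthonormal_basis c k l V C" "V \<subseteq> cusp_forms k l" and f: "f \<in> V"
  shows "f z = (\<Sum>b\<in>C. petersson c k l f b * b z)"
proof -
  obtain u where u: "f = (\<lambda>z. \<Sum>b\<in>C. u b * b z)" using orthonormal_basis_combination[OF V(1) f] .
  have C: "C \<subseteq> cusp_forms k l" "finite C" using V by (auto simp: orthonormal_basis_def)
  have "petersson c k l f b = u b" if b: "b \<in> C" for b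
  proof -
    have "petersson c k l f b = (\<Sum>b'\<in>C. u b' * petersson c k l b' b)"
      unfolding u using C b by (intro petersson_sum_left[OF onb]) auto
    also have "\<dots> = (\<Sum>b'\<in>C. if b' = b then u b' else 0)"
      using V(1) b by (intro sum.cong) (auto simp: orthonormal_basis_def)
    finally show ?thesis using b C by simp
  qed
  thus ?thesis by (subst u) simp
qed

text \<open>Lets two traces be identified through the functionals they represent, without comparing
  their coset sums.\<close>

lemma petersson_eqI:
  assumes onb: "orthonormal_basis c k l (cusp_forms k l) B"
    and "f \<in> cusp_forms k l" "g \<in> cusp_forms k l"
    and "\<And>h. h \<in> cusp_forms k l \<Longrightarrow> petersson c k l f h = petersson c k l g h"
  shows "f = g"
proof
  fix z
  have "B \<subseteq> cusp_forms k l" using onb by (auto simp: orthonormal_basis_def)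
  hence "(\<Sum>b\<in>B. petersson c k l f b * b z) = (\<Sum>b\<in>B. petersson c k l g b * b z)"
    using assms(4) by (intro sum.cong) auto
  thus "f z = g z"
    using orthonormal_basis_expansion[OF onb onb subset_refl assms(2)]
      orthonormal_basis_expansion[OF onb onb subset_refl assms(3)] by simp
qed

subsection \<open>The alternating sum of kernels\<close>

text \<open>The fixed point w, where the conjugate is evaluated, comes first so that the partial
  application is a form in z.\<close>

definition raised_kernel :: "nat \<Rightarrow> nat \<Rightarrow> (complex \<Rightarrow> complex) set \<Rightarrow> complex \<Rightarrow> complex \<Rightarrow> complex" where
  "raised_kernel k d B w z = (\<Sum>f\<in>B. level_raise k d f z * cnj (level_raise k d f w))"

definition mobius_kernel :: "nat \<Rightarrow> nat \<Rightarrow> (nat \<Rightarrow> (complex \<Rightarrow> complex) set) \<Rightarrow> complex \<Rightarrow> complex \<Rightarrow> complex" where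
  "mobius_kernel k q B w z = (\<Sum>d | d dvd q. \<Sum>e | e dvd q.
     of_int (mobius_mu d * mobius_mu e) * raised_kernel k d (B (q div (d * e))) w z)"

section \<open>Moebius cancellation and the arithmetic of the cube condition\<close>

lemma mobius_mu_mult_prime:
  assumes "squarefree e" "prime p" "\<not> p dvd e"
  shows "squarefree (e * p)" "mobius_mu (e * p) = - mobius_mu e"
proof -
  have "coprime e p" using prime_imp_coprime_nat[OF assms(2,3)] by (simp add: coprime_commute)
  thus sq: "squarefree (e * p)"
    using assms by (simp add: squarefree_mult_coprime squarefree_prime)
  have "e \<noteq> 0" "p \<noteq> 0" using assms by (auto simp: prime_gt_0_nat intro: ccontr)
  hence "prime_factors (e * p) = insert p (prime_factors e)"
    using assms by (auto simp: prime_factors_product prime_prime_factors)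
  moreover have "p \<notin> prime_factors e" using assms by auto
  ultimately show "mobius_mu (e * p) = - mobius_mu e"
    using sq assms by (simp add: mobius_mu_def)
qed

text \<open>The squarefree divisors fall into pairs e and e p with e prime to p; the terms of a pair
  have opposite signs and equal values.\<close>

lemma sum_mobius_cancel:
  fixes a :: "nat \<Rightarrow> complex"
  assumes q: "q > 0" and p: "prime p" "p dvd q"
    and eq: "\<And>e. e dvd q \<Longrightarrow> squarefree e \<Longrightarrow> \<not> p dvd e \<Longrightarrow> a (e * p) = a e"
  shows "(\<Sum>e | e dvd q. of_int (mobius_mu e) * a e) = 0"
proof -
  define S where "S = {e. e dvd q \<and> squarefree e \<and> \<not> p dvd e}"
  have fin: "finite {e. e dvd q}" using q by simp
  hence finS: "finite S" by (rule finite_subset[rotated]) (auto simp: S_def)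
  have inj: "inj_on (\<lambda>e. e * p) S" using p by (auto simp: inj_on_def prime_gt_0_nat)
  have sub: "S \<union> (\<lambda>e. e * p) ` S \<subseteq> {e. e dvd q}"
  proof -
    have "e * p dvd q" if "e \<in> S" for e
      using that p prime_imp_coprime_nat[OF p(1), of e]
      by (intro divides_mult) (auto simp: S_def coprime_commute)
    thus ?thesis by (auto simp: S_def)
  qed
  have rest: "mobius_mu e = 0" if e: "e \<in> {e. e dvd q} - (S \<union> (\<lambda>e. e * p) ` S)" for e
  proof (rule ccontr)
    assume "mobius_mu e \<noteq> 0"
    hence sq: "squarefree e" by (auto simp: mobius_mu_def split: if_splits)
    hence "p dvd e" using e by (auto simp: S_def)
    then obtain e' where e': "e = e' * p" by (metis dvd_def mult.commute)
    have "\<not> p dvd e'"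
    proof
      assume "p dvd e'"
      hence "p\<^sup>2 dvd e" by (auto simp: e' power2_eq_square)
      thus False using sq p squarefreeD[of e p] by auto
    qed
    moreover have "squarefree e'" using sq squarefree_mono[of e' e] by (simp add: e')
    moreover have "e' dvd q" using e by (auto simp: e' dest: dvd_mult_left)
    ultimately have "e' \<in> S" by (simp add: S_def)
    thus False using e e' by auto
  qed
  have "(\<Sum>e | e dvd q. of_int (mobius_mu e) * a e) = (\<Sum>e\<in>S \<union> (\<lambda>e. e * p) ` S. of_int (mobius_mu e) * a e)"
    using fin sub rest by (intro sum.mono_neutral_right) auto
  also have "\<dots> = (\<Sum>e\<in>S. of_int (mobius_mu e) * a e) + (\<Sum>e\<in>(\<lambda>e. e * p) ` S. of_int (mobius_mu e) * a e)"
    using finS by (intro sum.union_disjoint) (auto simp: S_def)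
  also have "(\<Sum>e\<in>(\<lambda>e. e * p) ` S. of_int (mobius_mu e) * a e) = (\<Sum>e\<in>S. - (of_int (mobius_mu e) * a e))"
    unfolding sum.reindex[OF inj] using p(1) eq
    by (intro sum.cong) (auto simp: S_def mobius_mu_mult_prime)
  finally show ?thesis by (simp add: sum_negf)
qed

text \<open>The place where cubes are used: a prime occurs at most once in each of d and e, hence at
  most twice in d e, but at least three times in q. So one factor always remains in the
  quotient.\<close>

lemma admissible_quotient:
  assumes q: "q > 0" and cube: "\<And>p. prime p \<Longrightarrow> p dvd q \<Longrightarrow> p ^ 3 dvd q"
    and d: "d dvd q" "squarefree d" and e: "e dvd q" "squarefree e"
  shows "admissible (q div (d * e)) d e" "q div (d * e) * d * e = q"
proof -
  have pos: "d > 0" "e > 0" using q d e by (auto intro: Nat.gr0I)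
  have mult: "multiplicity p (d * e) + 1 \<le> multiplicity p q" if p: "prime p" "p dvd q" for p
  proof -
    have "multiplicity p x \<le> 1" if "squarefree x" for x
    proof (rule ccontr)
      assume "\<not> multiplicity p x \<le> 1"
      hence "p\<^sup>2 dvd x" by (intro multiplicity_dvd') simp
      thus False using squarefreeD[OF that, of p] p(1) by (auto simp: prime_nat_iff)
    qed
    hence "multiplicity p d \<le> 1" "multiplicity p e \<le> 1" using d e by auto
    moreover have "3 \<le> multiplicity p q"
      using cube[OF p] p q by (intro multiplicity_geI) auto
    ultimately show ?thesis
      using p(1) pos by (simp add: prime_elem_multiplicity_mult_distrib)
  qed
  have "d * e dvd q"
  proof (rule multiplicity_le_imp_dvd)
    fix p :: nat assume p: "prime p"
    show "multiplicity p (d * e) \<le> multiplicity p q"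
    proof (cases "p dvd q")
      case True
      thus ?thesis using mult[OF p] by simp
    next
      case False
      hence "\<not> p dvd d * e" using p d(1) e(1) by (auto simp: prime_dvd_mult_iff dest: dvd_trans)
      thus ?thesis by (simp add: not_dvd_imp_multiplicity_0)
    qed
  qed (use pos in auto)
  then obtain M where M: "q = d * e * M" by (elim dvdE)
  have Mq: "q div (d * e) = M" using M pos by simp
  show "q div (d * e) * d * e = q" unfolding Mq using M by (simp add: mult_ac)
  have "p dvd M" if p: "prime p" "p dvd d * e" for p
  proof (rule ccontr)
    assume "\<not> p dvd M"
    hence "multiplicity p q = multiplicity p (d * e)"
      using p pos q M by (simp add: prime_elem_multiplicity_mult_distrib not_dvd_imp_multiplicity_0)
    moreover have "p dvd q" using p M by auto
    ultimately show False using mult[OF p(1)] by simp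
  qed
  thus "admissible (q div (d * e)) d e"
    unfolding Mq admissible_def using pos M q by auto
qed

lemma admissible_mono:
  assumes "admissible L d e" "d' dvd d" "e' dvd e" "L dvd L'" "L' > 0"
  shows "admissible L' d' e'"
proof -
  have "p dvd L'" if "prime p" "p dvd d' * e'" for p
    using assms that mult_dvd_mono[OF assms(2,3)] unfolding admissible_def by (meson dvd_trans)
  thus ?thesis using assms by (auto simp: admissible_def intro: dvd_pos_nat)
qed

lemma div_dvd_self: "p dvd q \<Longrightarrow> q div p dvd (q :: nat)"
  by (metis dvd_div_mult_self dvd_triv_left)

lemma admissible_1: "L > 0 \<Longrightarrow> prime p \<Longrightarrow> p dvd L \<Longrightarrow> admissible L (Suc 0) p"
  and admissible_1': "L > 0 \<Longrightarrow> prime p \<Longrightarrow> p dvd L \<Longrightarrow> admissible L p (Suc 0)"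
  by (auto simp: admissible_def primes_dvd_imp_eq prime_gt_0_nat)

section \<open>Trace identities, given orthonormal bases at every level\<close>

context
  fixes k :: nat and c :: real and B :: "nat \<Rightarrow> (complex \<Rightarrow> complex) set"
  assumes onb: "\<And>l. l > 0 \<Longrightarrow> orthonormal_basis c k l (cusp_forms k l) (B l)"
begin

lemma petersson_trace:
  assumes adm: "admissible L d e" and g: "g \<in> cusp_forms k (L * d * e)" and h: "h \<in> cusp_forms k L"
  shows "petersson c k (L * d * e) g (level_raise k d h) = petersson c k L (trace_form k d e L g) h"
proof -
  have pos: "L * d * e > 0" and d: "d > 0" using adm by (auto simp: admissible_def)
  have "level_raise k d h \<in> cusp_forms k (L * d * e)"
    using level_raise_cusp_form[OF d h] cusp_forms_mono[of "L * d" "L * d * e" k] by auto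
  from petersson_integrable_cusp_forms[OF onb[OF pos] g this]
  show ?thesis by (rule petersson_trace_form[OF adm g h])
qed

text \<open>Adjointness combined with trace after raising being the identity. The case d = 1 says
  that inclusion into a higher level is isometric, the case e = 1 that raising is.\<close>

lemma petersson_level_raise:
  assumes adm: "admissible L d e" and f: "f \<in> cusp_forms k L" and h: "h \<in> cusp_forms k L"
  shows "petersson c k (L * d * e) (level_raise k d f) (level_raise k d h) = petersson c k L f h"
proof -
  have "level_raise k d f \<in> cusp_forms k (L * d * e)"
    using level_raise_cusp_form[OF _ f, of d] cusp_forms_mono[of "L * d" "L * d * e" k] adm
    by (auto simp: admissible_def)
  thus ?thesis using petersson_trace[OF adm _ h] trace_form_level_raise[OF adm f] by simp
qed

text \<open>Tracing to L can be done in stages through L p. For g of level L d e the trace to L p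
  already has level L, so the last stage changes nothing. Both sides are compared as functionals on
  forms h of level L, with h viewed at level L p in between.\<close>

lemma trace_form_lower_eq:
  assumes adm: "admissible L d (e * p)" and p: "prime p" "\<not> p dvd e" and g: "g \<in> cusp_forms k (L * d * e)"
  shows "trace_form k d (e * p) L g = trace_form k d e (L * p) g"
proof (rule petersson_eqI)
  have pL: "p dvd L" and L: "L > 0" using adm p(1) by (auto simp: admissible_def)
  have adm': "admissible L d e" and admp: "admissible (L * p) d e"
    using admissible_mono[OF adm, of d e] L p(1) by (auto simp: prime_gt_0_nat)
  have cop: "coprime p e" using p by (simp add: prime_imp_coprime_nat)
  show "orthonormal_basis c k L (cusp_forms k L) (B L)" by (rule onb[OF L])
  have g': "g \<in> cusp_forms k (L * d * (e * p))"
    using g cusp_forms_mono[of "L * d * e" "L * d * (e * p)" k] by auto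
  show "trace_form k d (e * p) L g \<in> cusp_forms k L"
    by (rule trace_sum_cusp_form[OF adm _ _ g']) auto
  show F: "trace_form k d e (L * p) g \<in> cusp_forms k L"
    by (rule trace_form_of_lower_level[OF adm' cop g])
  fix h assume h: "h \<in> cusp_forms k L"
  have h': "h \<in> cusp_forms k (L * p)" using h cusp_forms_mono[of L "L * p" k] by auto
  have eq: "L * d * (e * p) = L * p * d * e" by simp
  have "petersson c k L (trace_form k d (e * p) L g) h =
      petersson c k (L * p * d * e) g (level_raise k d h)"
    using petersson_trace[OF adm g' h] unfolding eq by simp
  also have "\<dots> = petersson c k (L * p) (trace_form k d e (L * p) g) h"
    using petersson_trace[OF admp _ h'] g' unfolding eq by simp
  also have "\<dots> = petersson c k L (trace_form k d e (L * p) g) h"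
    using petersson_level_raise[OF admissible_1[OF L p(1) pL] F h] by simp
  finally show "petersson c k L (trace_form k d (e * p) L g) h =
      petersson c k L (trace_form k d e (L * p) g) h" .
qed

text \<open>The dual of the preceding cancellation: the trace to L p is f raised by p, and the
  remaining stage, the adjoint of raising by p, recovers f. Raising by d p on one side and by d on
  the other then gives the same form.\<close>

lemma trace_form_raised_eq:
  assumes adm: "admissible L (d * p) e" and p: "prime p" "\<not> p dvd d" and g: "g \<in> cusp_forms k (L * d * e)"
  shows "level_raise k (d * p) (trace_form k (d * p) e L (level_raise k p g)) =
    level_raise k d (trace_form k d e (L * p) (level_raise k p g))"
proof -
  have pL: "p dvd L" and L: "L > 0" using adm p(1) by (auto simp: admissible_def)
  have adm': "admissible L d e" and admp: "admissible (L * p) d e"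
    using admissible_mono[OF adm, of d e] L p(1) by (auto simp: prime_gt_0_nat)
  have p0: "p > 0" using p(1) by (rule prime_gt_0_nat)
  have cop: "coprime p d" using p by (simp add: prime_imp_coprime_nat)
  obtain f where f: "f \<in> cusp_forms k L" "trace_form k d e (L * p) (level_raise k p g) = level_raise k p f"
    using trace_form_of_raised[OF adm' cop p0 g] by blast
  have eq: "L * (d * p) * e = L * p * d * e" "L * d * e * p = L * p * d * e" by simp_all
  have g': "level_raise k p g \<in> cusp_forms k (L * p * d * e)"
    using level_raise_cusp_form[OF p0 g] unfolding eq .
  have "trace_form k (d * p) e L (level_raise k p g) = f"
  proof (rule petersson_eqI)
    show "orthonormal_basis c k L (cusp_forms k L) (B L)" by (rule onb[OF L])
    show "f \<in> cusp_forms k L" by (rule f(1))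
    show "trace_form k (d * p) e L (level_raise k p g) \<in> cusp_forms k L"
      by (rule trace_sum_cusp_form[OF adm]) (use g' in \<open>simp_all add: eq\<close>)
    fix h assume h: "h \<in> cusp_forms k L"
    have h': "level_raise k p h \<in> cusp_forms k (L * p)" by (rule level_raise_cusp_form[OF p0 h])
    have "petersson c k L (trace_form k (d * p) e L (level_raise k p g)) h =
        petersson c k (L * p * d * e) (level_raise k p g) (level_raise k d (level_raise k p h))"
      using petersson_trace[OF adm _ h] g' unfolding eq level_raise_mult by simp
    also have "\<dots> = petersson c k (L * p) (level_raise k p f) (level_raise k p h)"
      using petersson_trace[OF admp g' h'] f(2) by simp
    also have "\<dots> = petersson c k L f h"
      using petersson_level_raise[OF admissible_1'[OF L p(1) pL] f(1) h] by simp
    finally show "petersson c k L (trace_form k (d * p) e L (level_raise k p g)) h = petersson c k L f h" .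
  qed
  thus ?thesis using f(2) by (simp add: level_raise_mult)
qed

lemma raised_kernel_cusp_form:
  assumes adm: "admissible L d e"
  shows "raised_kernel k d (B L) w \<in> cusp_forms k (L * d * e)"
proof -
  have "(\<lambda>z. \<Sum>f\<in>B L. cnj (level_raise k d f w) * level_raise k d f z) \<in> cusp_forms k (L * d * e)"
  proof (intro cusp_forms_sum cusp_forms_scale)
    fix f assume "f \<in> B L"
    hence "f \<in> cusp_forms k L" using onb[of L] adm by (auto simp: orthonormal_basis_def admissible_def)
    thus "level_raise k d f \<in> cusp_forms k (L * d * e)"
      using level_raise_cusp_form[of d f k L] cusp_forms_mono[of "L * d" "L * d * e" k] adm
      by (auto simp: admissible_def)
  qed
  thus ?thesis by (simp add: raised_kernel_def[abs_def] mult.commute)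
qed

text \<open>Adjointness turns the coefficients against raised basis forms into the coefficients of
  the trace in the basis \<open>B L\<close>, and their sum rebuilds the trace. The value does not
  involve the basis.\<close>

lemma petersson_raised_kernel:
  assumes adm: "admissible L d e" and g: "g \<in> cusp_forms k (L * d * e)"
  shows "petersson c k (L * d * e) g (raised_kernel k d (B L) w) =
    level_raise k d (trace_form k d e L g) w"
proof -
  have pos: "L > 0" "d > 0" "L * d * e > 0" using adm by (auto simp: admissible_def)
  have BL: "f \<in> cusp_forms k L" if "f \<in> B L" for f
    using onb[OF pos(1)] that by (auto simp: orthonormal_basis_def)
  have raise: "level_raise k d f \<in> cusp_forms k (L * d * e)" if "f \<in> B L" for f
    using level_raise_cusp_form[OF pos(2) BL[OF that]] cusp_forms_mono[of "L * d" "L * d * e" k] by auto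
  have tr: "trace_form k d e L g \<in> cusp_forms k L" by (rule trace_sum_cusp_form[OF adm _ _ g]) auto
  have "raised_kernel k d (B L) w = (\<lambda>z. \<Sum>f\<in>B L. cnj (level_raise k d f w) * level_raise k d f z)"
    by (simp add: raised_kernel_def fun_eq_iff mult.commute)
  hence "petersson c k (L * d * e) g (raised_kernel k d (B L) w) =
      (\<Sum>f\<in>B L. level_raise k d f w * petersson c k (L * d * e) g (level_raise k d f))"
    using petersson_sum_right[OF onb[OF pos(3)] raise g, where a = "\<lambda>f. cnj (level_raise k d f w)"] by simp
  also have "\<dots> = (\<Sum>f\<in>B L. petersson c k L (trace_form k d e L g) f * level_raise k d f w)"
    by (intro sum.cong refl) (simp add: petersson_trace[OF adm g BL])
  also have "\<dots> = level_raise k d (\<lambda>z. \<Sum>f\<in>B L. petersson c k L (trace_form k d e L g) f * f z) w"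
    by (rule level_raise_sum[symmetric])
  also have "(\<lambda>z. \<Sum>f\<in>B L. petersson c k L (trace_form k d e L g) f * f z) = trace_form k d e L g"
    using orthonormal_basis_expansion[OF onb[OF pos(1)] onb[OF pos(1)] subset_refl tr] by (simp add: fun_eq_iff)
  finally show ?thesis .
qed

section \<open>The Moebius kernel at a level satisfying the cube condition\<close>

context
  fixes q :: nat
  assumes q: "q > 0" and cube: "\<And>p. prime p \<Longrightarrow> p dvd q \<Longrightarrow> p ^ 3 dvd q"
begin

definition pairing :: "(complex \<Rightarrow> complex) \<Rightarrow> complex \<Rightarrow> nat \<Rightarrow> nat \<Rightarrow> complex" where
  "pairing g w d e = petersson c k q g (raised_kernel k d (B (q div (d * e))) w)"

lemma pairing_eq:
  assumes "d dvd q" "squarefree d" "e dvd q" "squarefree e" "g \<in> cusp_forms k q"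
  shows "pairing g w d e = level_raise k d (trace_form k d e (q div (d * e)) g) w"
  using petersson_raised_kernel[OF admissible_quotient(1)[OF q cube assms(1-4)], of g w]
    admissible_quotient(2)[OF q cube assms(1-4)] assms(5) by (simp add: pairing_def)

lemma mobius_kernel_cusp_form: "mobius_kernel k q B w \<in> cusp_forms k q"
  unfolding mobius_kernel_def[abs_def]
proof (intro cusp_forms_sum)
  fix d e assume "d \<in> {d. d dvd q}" "e \<in> {e. e dvd q}"
  hence de: "d dvd q" "e dvd q" by auto
  show "(\<lambda>z. of_int (mobius_mu d * mobius_mu e) * raised_kernel k d (B (q div (d * e))) w z) \<in> cusp_forms k q"
  proof (cases "squarefree d \<and> squarefree e")
    case True
    note adm = admissible_quotient[OF q cube de(1) _ de(2)]
    show ?thesis using raised_kernel_cusp_form[OF adm(1), of w] adm(2) True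
      by (intro cusp_forms_scale) auto
  next
    case False
    hence "mobius_mu d * mobius_mu e = 0" by (auto simp: mobius_mu_def)
    thus ?thesis by (simp only: of_int_0 mult_zero_left cusp_forms_zero)
  qed
qed

text \<open>Non-squarefree indices are dropped before linearity is applied, since only for
  squarefree d and e is the kernel known to be a cusp form of level q.\<close>

lemma petersson_mobius_kernel:
  assumes g: "g \<in> cusp_forms k q"
  shows "petersson c k q g (mobius_kernel k q B w) =
    (\<Sum>d | d dvd q. \<Sum>e | e dvd q. of_int (mobius_mu d * mobius_mu e) * pairing g w d e)"
proof -
  define S where "S = {d. d dvd q \<and> squarefree d}"
  have fin: "finite {d. d dvd q}" using q by simp
  have SS: "(\<Sum>d | d dvd q. \<Sum>e | e dvd q. of_int (mobius_mu d * mobius_mu e) * x d e) =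
      (\<Sum>p\<in>S \<times> S. of_int (mobius_mu (fst p) * mobius_mu (snd p)) * x (fst p) (snd p))" for x :: "nat \<Rightarrow> nat \<Rightarrow> complex"
  proof -
    have "(\<Sum>d | d dvd q. \<Sum>e | e dvd q. of_int (mobius_mu d * mobius_mu e) * x d e) =
        (\<Sum>p\<in>{d. d dvd q} \<times> {d. d dvd q}. of_int (mobius_mu (fst p) * mobius_mu (snd p)) * x (fst p) (snd p))"
      by (simp add: sum.cartesian_product case_prod_unfold)
    also have "\<dots> = (\<Sum>p\<in>S \<times> S. of_int (mobius_mu (fst p) * mobius_mu (snd p)) * x (fst p) (snd p))"
      using fin by (intro sum.mono_neutral_right) (auto simp: S_def mobius_mu_def)
    finally show ?thesis .
  qed
  have "mobius_kernel k q B w = (\<lambda>z. \<Sum>p\<in>S \<times> S. of_int (mobius_mu (fst p) * mobius_mu (snd p)) *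
      raised_kernel k (fst p) (B (q div (fst p * snd p))) w z)"
    by (simp only: mobius_kernel_def[abs_def] SS)
  moreover have "raised_kernel k (fst p) (B (q div (fst p * snd p))) w \<in> cusp_forms k q" if "p \<in> S \<times> S" for p
  proof -
    have p: "fst p dvd q" "squarefree (fst p)" "snd p dvd q" "squarefree (snd p)"
      using that by (auto simp: S_def)
    show ?thesis using raised_kernel_cusp_form[OF admissible_quotient(1)[OF q cube p], of w]
        admissible_quotient(2)[OF q cube p] by simp
  qed
  ultimately show ?thesis
    unfolding SS pairing_def using petersson_sum_right[OF onb[OF q] _ g,
        of "S \<times> S" "\<lambda>p. raised_kernel k (fst p) (B (q div (fst p * snd p))) w"
          "\<lambda>p. of_int (mobius_mu (fst p) * mobius_mu (snd p))"] by simp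
qed

text \<open>With L = q/(d e p), the last equation says that q/p is the level L d e at which the
  trace identities want their form.\<close>

lemma quotient_mult_prime:
  assumes "d dvd q" "squarefree d" "e dvd q" "squarefree e" "prime p" "p dvd q" "\<not> p dvd e"
  shows "e * p dvd q" "squarefree (e * p)" "q div (d * e) = q div (d * (e * p)) * p"
    "q div (d * (e * p)) * d * e = q div p"
proof -
  have "coprime e p" using prime_imp_coprime_nat[OF assms(5,7)] by (simp add: coprime_commute)
  thus ep: "e * p dvd q" using assms by (intro divides_mult) auto
  show sq: "squarefree (e * p)" using mobius_mu_mult_prime(1) assms by blast
  define L where "L = q div (d * (e * p))"
  have L: "q = L * d * (e * p)"
    using admissible_quotient(2)[OF q cube assms(1,2) ep sq] by (simp add: L_def)
  have "L > 0" "d > 0" "e > 0" "p > 0" using L q by auto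
  moreover have "q = L * p * (d * e)" "q = L * d * e * p" by (simp_all add: L)
  ultimately have "q div (d * e) = L * p" "q div p = L * d * e"
    by (metis nonzero_mult_div_cancel_right mult_pos_pos not_gr0)+
  thus "q div (d * e) = q div (d * (e * p)) * p" "q div (d * (e * p)) * d * e = q div p"
    by (simp_all add: L_def)
qed

lemma mobius_kernel_orthogonal_lower:
  assumes p: "prime p" "p dvd q" and g: "g \<in> cusp_forms k (q div p)"
  shows "petersson c k q g (mobius_kernel k q B w) = 0"
proof -
  have gq: "g \<in> cusp_forms k q" using g cusp_forms_mono[OF div_dvd_self[OF p(2)]] by blast
  have "(\<Sum>e | e dvd q. of_int (mobius_mu d * mobius_mu e) * pairing g w d e) = 0"
    if d: "d dvd q" for d
  proof (cases "squarefree d")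
    case True
    have "pairing g w d (e * p) = pairing g w d e" if e: "e dvd q" "squarefree e" "\<not> p dvd e" for e
    proof -
      note qp = quotient_mult_prime[OF d True e(1,2) p e(3)]
      have "trace_form k d (e * p) (q div (d * (e * p))) g = trace_form k d e (q div (d * e)) g"
        unfolding qp(3) by (rule trace_form_lower_eq[OF admissible_quotient(1)[OF q cube d True qp(1,2)] p(1) e(3)])
          (simp_all only: qp(4) g)
      thus ?thesis using pairing_eq[OF d True qp(1,2) gq] pairing_eq[OF d True e(1,2) gq] by simp
    qed
    hence "(\<Sum>e | e dvd q. of_int (mobius_mu e) * pairing g w d e) = 0"
      by (intro sum_mobius_cancel[OF q p])
    thus ?thesis by (simp add: mult.assoc flip: sum_distrib_left)
  qed (simp add: mobius_mu_def)
  thus ?thesis using petersson_mobius_kernel[OF gq] by simp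
qed

lemma mobius_kernel_orthogonal_raised:
  assumes p: "prime p" "p dvd q" and g: "g \<in> cusp_forms k (q div p)"
  shows "petersson c k q (level_raise k p g) (mobius_kernel k q B w) = 0"
proof -
  define G where "G = level_raise k p g"
  have gq: "G \<in> cusp_forms k q"
    using level_raise_cusp_form[OF prime_gt_0_nat[OF p(1)] g] p by (simp add: G_def)
  have "(\<Sum>d | d dvd q. of_int (mobius_mu d * mobius_mu e) * pairing G w d e) = 0"
    if e: "e dvd q" for e
  proof (cases "squarefree e")
    case True
    have "pairing G w (d * p) e = pairing G w d e" if d: "d dvd q" "squarefree d" "\<not> p dvd d" for d
    proof -
      \<comment> \<open>Applied with the roles of d and e exchanged, since the extra prime now goes
        into d.\<close>
      note qp = quotient_mult_prime[OF e True d(1,2) p d(3)]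
      have eqs: "q div (d * e) = q div (d * p * e) * p" "q div (d * p * e) * d * e = q div p"
        using qp(3,4) by (simp_all add: mult_ac)
      have "level_raise k (d * p) (trace_form k (d * p) e (q div (d * p * e)) G) =
          level_raise k d (trace_form k d e (q div (d * e)) G)"
        unfolding eqs(1) G_def
        by (rule trace_form_raised_eq[OF admissible_quotient(1)[OF q cube qp(1,2) e True] p(1) d(3)])
          (simp_all only: eqs(2) g)
      thus ?thesis using pairing_eq[OF qp(1,2) e True gq] pairing_eq[OF d(1,2) e True gq] by simp
    qed
    hence "(\<Sum>d | d dvd q. of_int (mobius_mu d) * pairing G w d e) = 0"
      by (intro sum_mobius_cancel[OF q p])
    moreover have "(\<Sum>d | d dvd q. of_int (mobius_mu d * mobius_mu e) * pairing G w d e) =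
        of_int (mobius_mu e) * (\<Sum>d | d dvd q. of_int (mobius_mu d) * pairing G w d e)"
      by (simp add: sum_distrib_left mult_ac)
    ultimately show ?thesis by simp
  qed (simp add: mobius_mu_def)
  thus ?thesis
    unfolding G_def[symmetric] petersson_mobius_kernel[OF gq] by (subst sum.swap) simp
qed

text \<open>One prime suffices. For d = 1, a prime of q/l' works because f already has level q/p.
  Otherwise a prime p of d works: raise by d/p first, which stays within level q/p, and by p
  last.\<close>

lemma oldspace_generator:
  assumes l': "l' dvd q" "l' \<noteq> q" and d: "d dvd q div l'" and f: "f \<in> cusp_forms k l'"
  obtains p g where "prime p" "p dvd q" "g \<in> cusp_forms k (q div p)"
    "level_raise k d f = g \<or> level_raise k d f = level_raise k p g"
proof (cases "d = 1")
  case True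
  have "q div l' \<noteq> 1" using l' q by (auto simp: dvd_def)
  then obtain p where p: "prime p" "p dvd q div l'" using prime_factor_nat by blast
  hence "l' * p dvd q" using l' by (metis dvd_mult_div_cancel mult_dvd_mono dvd_refl)
  hence "p dvd q" "l' dvd q div p"
    using p(1) by (auto simp: dvd_div_iff_mult prime_gt_0_nat dest: dvd_mult_right)
  moreover have "f \<in> cusp_forms k (q div p)"
    using f cusp_forms_mono[OF \<open>l' dvd q div p\<close>] by blast
  ultimately show ?thesis using that[of p f] p True by simp
next
  case False
  then obtain p where p: "prime p" "p dvd d" using prime_factor_nat by blast
  then obtain d' where d': "d = p * d'" by (elim dvdE)
  have "l' * d dvd q" using l' d by (metis dvd_mult_div_cancel mult_dvd_mono dvd_refl)
  hence dvd: "l' * d' * p dvd q" by (simp add: d' mult_ac)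
  hence pq: "p dvd q" by (rule dvd_mult_right)
  have sub: "l' * d' dvd q div p"
    using dvd p(1) pq by (simp add: dvd_div_iff_mult prime_gt_0_nat)
  have "d' > 0" using dvd q by (auto intro: Nat.gr0I)
  hence "level_raise k d' f \<in> cusp_forms k (q div p)"
    using level_raise_cusp_form[OF _ f] cusp_forms_mono[OF sub] by blast
  thus ?thesis using that[OF p(1) pq] by (metis d' level_raise_mult)
qed

text \<open>Membership in \<open>cusp_forms k q\<close> is carried through the induction because
  additivity of the pairing requires it.\<close>

lemma mobius_kernel_orthogonal_oldspace:
  assumes "g \<in> oldspace k q"
  shows "g \<in> cusp_forms k q \<and> petersson c k q g (mobius_kernel k q B w) = 0"
  using assms unfolding oldspace_def
proof (induction rule: cfun.span_induct_alt)
  case base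
  have "petersson c k q (\<lambda>z. \<Sum>i\<in>{}. a i * f i z) (mobius_kernel k q B w) = 0" for a f :: "unit \<Rightarrow> _"
    unfolding petersson_def by simp
  thus ?case using cusp_forms_zero by (simp add: zero_fun_def)
next
  case (step a x y)
  then obtain l' d f where x: "x = level_raise k d f" "l' dvd q" "l' \<noteq> q" "d dvd q div l'" "f \<in> cusp_forms k l'"
    by blast
  obtain p g where g: "prime p" "p dvd q" "g \<in> cusp_forms k (q div p)" "x = g \<or> x = level_raise k p g"
    using oldspace_generator[OF x(2-5)] unfolding x(1) by metis
  have "g \<in> cusp_forms k q" "level_raise k p g \<in> cusp_forms k q"
    using g(3) cusp_forms_mono[OF div_dvd_self[OF g(2)]]
      level_raise_cusp_form[OF prime_gt_0_nat[OF g(1)] g(3)] g(2) by auto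
  hence xq: "x \<in> cusp_forms k q" using g(4) by auto
  have x0: "petersson c k q x (mobius_kernel k q B w) = 0"
    using mobius_kernel_orthogonal_lower[OF g(1-3)] mobius_kernel_orthogonal_raised[OF g(1-3)] g(4) by auto
  have eq: "(\<lambda>z. a * x z) + y = (\<lambda>z. \<Sum>i\<in>{True, False}. (if i then a else 1) * (if i then x else y) z)"
    by (simp add: fun_eq_iff)
  have "petersson c k q ((\<lambda>z. a * x z) + y) (mobius_kernel k q B w) =
      (\<Sum>i\<in>{True, False}. (if i then a else 1) * petersson c k q (if i then x else y) (mobius_kernel k q B w))"
    unfolding eq using xq step by (intro petersson_sum_left[OF onb[OF q] _ mobius_kernel_cusp_form]) auto
  moreover have "(\<lambda>z. a * x z) + y \<in> cusp_forms k q"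
    unfolding plus_fun_def using xq step by (intro cusp_forms_add cusp_forms_scale) auto
  ultimately show ?case unfolding plus_fun_def using x0 step by simp
qed

lemma mobius_kernel_newspace: "mobius_kernel k q B w \<in> newspace c k q"
  using mobius_kernel_cusp_form mobius_kernel_orthogonal_oldspace
  by (simp add: newspace_def petersson_cnj[of c k q "mobius_kernel k q B w"])

text \<open>For (d, e) other than (1, 1), the kernel is a combination of forms raised from the
  proper divisor q/(d e), hence old and orthogonal to f. The remaining term is the reproducing
  kernel of all cusp forms of level q.\<close>

lemma mobius_kernel_reproducing:
  assumes f: "f \<in> newspace c k q"
  shows "petersson c k q f (mobius_kernel k q B w) = f w"
proof -
  have fq: "f \<in> cusp_forms k q" using f by (simp add: newspace_def)
  have fin: "finite {d. d dvd q}" using q by simp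
  have zero: "of_int (mobius_mu d * mobius_mu e) * pairing f w d e = 0"
    if de: "d dvd q" "e dvd q" "\<not> (d = 1 \<and> e = 1)" for d e
  proof (cases "squarefree d \<and> squarefree e")
    case True
    define M where "M = q div (d * e)"
    have M: "M * d * e = q" using admissible_quotient(2)[OF q cube de(1) _ de(2)] True by (simp add: M_def)
    hence Mpos: "M > 0" using q by auto
    have "M \<noteq> q" using M q de(3) by (auto simp: mult.assoc)
    moreover have "M dvd q" using M by (metis dvd_triv_left mult.assoc)
    moreover have "d dvd q div M"
    proof -
      have "q div M = d * e" using M Mpos by (metis mult.assoc nonzero_mult_div_cancel_left not_gr0)
      thus ?thesis by simp
    qed
    ultimately have gen: "level_raise k d b \<in> oldspace k q" if "b \<in> B M" for b
      unfolding oldspace_def using that onb[OF Mpos]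
      by (intro cfun.span_base) (auto simp: orthonormal_basis_def)
    have "raised_kernel k d (B M) w = (\<Sum>b\<in>B M. (\<lambda>z. cnj (level_raise k d b w) * level_raise k d b z))"
      by (simp add: fun_eq_iff raised_kernel_def sum_apply mult.commute)
    hence "raised_kernel k d (B M) w \<in> oldspace k q"
      using gen unfolding oldspace_def by (auto intro!: cfun.span_sum cfun.span_scale)
    hence "pairing f w d e = 0" using f by (simp add: newspace_def pairing_def M_def)
    thus ?thesis by simp
  qed (auto simp: mobius_mu_def)
  \<comment> \<open>For d = e = 1 the trace is the identity.\<close>
  have one: "pairing f w 1 1 = f w"
    using pairing_eq[of 1 1 f w] fq trace_form_level_raise[of q 1 1 f k] q
    by (simp add: admissible_def)
  have "(\<Sum>d | d dvd q. \<Sum>e | e dvd q. of_int (mobius_mu d * mobius_mu e) * pairing f w d e) =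
      (\<Sum>d | d dvd q. \<Sum>e | e dvd q. if d = 1 \<and> e = 1 then f w else 0)"
    using zero one by (intro sum.cong refl) (auto simp: mobius_mu_def)
  also have "\<dots> = (\<Sum>d | d dvd q. if d = 1 then f w else 0)"
    using fin by (intro sum.cong refl) auto
  also have "\<dots> = f w" using fin by simp
  finally show ?thesis using petersson_mobius_kernel[OF fq] by simp
qed

end

end

text \<open>The Moebius kernel at \<open>z2\<close> is a newform R. Its coefficient against a basis
  form f is the conjugate of the pairing of f with R, which is f(\<open>z2\<close>), so expanding R
  at \<open>z1\<close> produces the left-hand side.\<close>

theorem theorem1:
  fixes k q :: nat and c :: real
    and B Bnew :: "nat \<Rightarrow> (complex \<Rightarrow> complex) set"
    and z1 z2 :: complex
  assumes "k > 0" and "q > 0"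
    and "\<And>p. prime p \<Longrightarrow> p dvd q \<Longrightarrow> p ^ 3 dvd q"
    and "c > 0"
    and "\<And>l. l > 0 \<Longrightarrow> orthonormal_basis c k l (cusp_forms k l) (B l)"
    and "\<And>l. l > 0 \<Longrightarrow> orthonormal_basis c k l (newspace c k l) (Bnew l)"
    and "z1 \<in> uhp" and "z2 \<in> uhp"
  shows "(\<Sum>f\<in>Bnew q. f z1 * cnj (f z2)) =
    (\<Sum>d | d dvd q. \<Sum>e | e dvd q. of_int (mobius_mu d * mobius_mu e) *
       (\<Sum>f\<in>B (q div (d * e)). level_raise k d f z1 * cnj (level_raise k d f z2)))"
proof -
  define R where "R = mobius_kernel k q B z2"
  have R: "R \<in> newspace c k q"
    unfolding R_def using assms(5,2,3) by (rule mobius_kernel_newspace)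
  have new: "newspace c k q \<subseteq> cusp_forms k q" by (auto simp: newspace_def)
  have "R z1 = (\<Sum>f\<in>Bnew q. petersson c k q R f * f z1)"
    by (rule orthonormal_basis_expansion[OF assms(5)[OF assms(2)] assms(6)[OF assms(2)] new R])
  also have "\<dots> = (\<Sum>f\<in>Bnew q. f z1 * cnj (f z2))"
  proof (rule sum.cong)
    fix f assume "f \<in> Bnew q"
    hence "f \<in> newspace c k q" using assms(6)[OF assms(2)] by (auto simp: orthonormal_basis_def)
    hence "petersson c k q f R = f z2"
      unfolding R_def using mobius_kernel_reproducing[OF assms(5,2,3)] by blast
    thus "petersson c k q R f * f z1 = f z1 * cnj (f z2)" by (subst petersson_cnj) simp
  qed simp
  finally show ?thesis by (simp add: R_def mobius_kernel_def raised_kernel_def)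
qed

end
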